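(* Let $0<p<1$. Let $C(2,p)$ denote the smallest real number such that $|a_2|\leq C(2,p)\|f\|_{H^p}$ holds for every $f(z)=\sum_{n\geq0}a_nz^n$ in $H^p$; equivalently, \[C(2,p)=\sup\left\{\operatorname{Re}\frac{f''(0)}{2!}\,:\,f\in H^p,\ \|f\|_{H^p}=1\right\}.\] Then \[C(2,p)=\frac{2}{p}\left(1-\frac{p}{2}\right)^{\frac{2}{p}-1}.\] Moreover, up to the rotations $f(z)\mapsto e^{-2i\theta}f(e^{i\theta}z)$ with $\theta\in\mathbb{R}$, the extremal function (the function $f$ in $H^p$ with $\|f\|_{H^p}=1$ attaining the supremum above) is \[f(z)=\left(1-\frac{p}{2}\right)^{\frac{2}{p}}\left(1+\sqrt{\frac{2p}{2-p}}\,z+\frac{p}{2-p}z^2\right)^{\frac{2}{p}}.\] That is, this $f$ attains the supremum, and the functions attaining the supremum are exactly the functions $z\mapsto e^{-2i\theta}f(e^{i\theta}z)$, $\theta\in\mathbb{R}$.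
   Context: For $0<p<\infty$, the Hardy space $H^p$ consists of the analytic functions $f$ in the unit disc $\mathbb{D}=\{z\in\mathbb{C}:|z|<1\}$ such that $\|f\|_{H^p}^p=\lim_{r\to1^-}\int_0^{2\pi}|f(re^{i\theta})|^p\,\frac{d\theta}{2\pi}<\infty$. For $0<p<1$ the quantity $\|\cdot\|_{H^p}$ is only a quasi-norm. The quadratic polynomial in the formula for $f$ does not vanish in $\mathbb{D}$, and its power $2/p$ denotes the analytic branch in $\mathbb{D}$ which takes the value $1$ at $z=0$. *)

theory Defs
  imports "HOL-Complex_Analysis.Complex_Analysis"
begin

section \<open>Hardy spaces on the unit disc\<close>

definition hardy_mean :: "real \<Rightarrow> (complex \<Rightarrow> complex) \<Rightarrow> real \<Rightarrow> real" where
  "hardy_mean p f r = integral {0..2*pi} (\<lambda>t. norm (f (of_real r * cis t)) powr p / (2*pi))"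

text \<open>
  Functions are total in HOL; only the values on the open unit disc are relevant.
  Finiteness of the limit of the integral means is expressed by convergence to a real number.
\<close>

definition hardy_space :: "real \<Rightarrow> (complex \<Rightarrow> complex) set" where
  "hardy_space p =
     {f. f holomorphic_on ball 0 1 \<and> (\<exists>L. (hardy_mean p f \<longlongrightarrow> L) (at_left 1))}"

definition hardy_norm :: "real \<Rightarrow> (complex \<Rightarrow> complex) \<Rightarrow> real" where
  "hardy_norm p f = (Lim (at_left 1) (hardy_mean p f)) powr (1/p)"

definition taylor_coeff :: "(complex \<Rightarrow> complex) \<Rightarrow> nat \<Rightarrow> complex" where
  "taylor_coeff f n = (deriv ^^ n) f 0 / fact n"

lemma taylor_coeff_sums:
  assumes "f holomorphic_on ball 0 1" "z \<in> ball 0 1"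
  shows "(\<lambda>n. taylor_coeff f n * z ^ n) sums f z"
  using holomorphic_power_series[OF assms] by (simp add: taylor_coeff_def)


section \<open>The coefficient problem\<close>

definition coeff_bounds :: "nat \<Rightarrow> real \<Rightarrow> real set" where
  "coeff_bounds n p = {C. \<forall>f\<in>hardy_space p. norm (taylor_coeff f n) \<le> C * hardy_norm p f}"

definition coeff_const :: "nat \<Rightarrow> real \<Rightarrow> real" where
  "coeff_const n p = (LEAST C. C \<in> coeff_bounds n p)"

definition coeff_sup :: "nat \<Rightarrow> real \<Rightarrow> real" where
  "coeff_sup n p = Sup {Re (taylor_coeff f n) |f. f \<in> hardy_space p \<and> hardy_norm p f = 1}"

definition coeff_extremal :: "nat \<Rightarrow> real \<Rightarrow> (complex \<Rightarrow> complex) \<Rightarrow> bool" where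
  "coeff_extremal n p f \<longleftrightarrow>
     f \<in> hardy_space p \<and> hardy_norm p f = 1 \<and> Re (taylor_coeff f n) = coeff_sup n p"


section \<open>Analytic branches of powers in the unit disc\<close>

text \<open>
  For \<open>q\<close> holomorphic and zero-free in the disc with \<open>q 0 = 1\<close>, the conditions below determine
  the logarithm uniquely on the disc, so \<open>disc_power q s\<close> is there the analytic branch
  of \<open>q\<^sup>s\<close> with value \<open>1\<close> at \<open>0\<close>.
\<close>

definition disc_log :: "(complex \<Rightarrow> complex) \<Rightarrow> complex \<Rightarrow> complex" where
  "disc_log q =
     (SOME L. L holomorphic_on ball 0 1 \<and> L 0 = 0 \<and> (\<forall>z\<in>ball 0 1. exp (L z) = q z))"

definition disc_power :: "(complex \<Rightarrow> complex) \<Rightarrow> real \<Rightarrow> complex \<Rightarrow> complex" where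
  "disc_power q s z = exp (of_real s * disc_log q z)"

lemma disc_log:
  assumes q: "q holomorphic_on ball 0 1" "\<And>z. z \<in> ball 0 1 \<Longrightarrow> q z \<noteq> 0" and q0: "q 0 = 1"
  shows "disc_log q holomorphic_on ball 0 1" "disc_log q 0 = 0"
    "\<And>z. z \<in> ball 0 1 \<Longrightarrow> exp (disc_log q z) = q z"
proof -
  obtain g where g: "g holomorphic_on ball 0 1" "\<And>z. z \<in> ball 0 1 \<Longrightarrow> q z = exp (g z)"
    using contractible_imp_holomorphic_log[OF q(1) _ q(2)]
    by (metis convex_imp_contractible convex_ball)
  have "exp (g 0) = 1" using g(2)[of 0] q0 by simp
  then have "(\<lambda>z. g z - g 0) holomorphic_on ball 0 1 \<and> g 0 - g 0 = 0 \<and>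
      (\<forall>z\<in>ball 0 1. exp (g z - g 0) = q z)"
    using g by (auto simp: exp_diff intro!: holomorphic_intros)
  then have "\<exists>L. L holomorphic_on ball 0 1 \<and> L 0 = 0 \<and> (\<forall>z\<in>ball 0 1. exp (L z) = q z)"
    by (intro exI[where x = "\<lambda>z. g z - g 0"])
  from someI_ex[OF this, folded disc_log_def]
  show "disc_log q holomorphic_on ball 0 1" "disc_log q 0 = 0"
    "\<And>z. z \<in> ball 0 1 \<Longrightarrow> exp (disc_log q z) = q z" by auto
qed

lemma disc_log_unique:
  assumes L: "L holomorphic_on ball 0 1" "L 0 = 0" "\<And>z. z \<in> ball 0 1 \<Longrightarrow> exp (L z) = q z"
    and z: "z \<in> ball 0 1"
  shows "disc_log q z = L z"
proof -
  have "q holomorphic_on ball 0 1"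
    by (rule holomorphic_transform[of "\<lambda>z. exp (L z)"]) (use L in \<open>auto intro!: holomorphic_intros\<close>)
  moreover have "q z \<noteq> 0" if "z \<in> ball 0 1" for z using L(3)[OF that] by (metis exp_not_eq_zero)
  moreover have "q 0 = 1" using L(2) L(3)[of 0] by simp
  ultimately have M: "disc_log q holomorphic_on ball 0 1" "disc_log q 0 = 0"
    "\<And>z. z \<in> ball 0 1 \<Longrightarrow> exp (disc_log q z) = q z" using disc_log[of q] by blast+
  define D where "D = (\<lambda>z. disc_log q z - L z)"
  have D: "D holomorphic_on ball 0 1" "D 0 = 0"
    using L M by (auto simp: D_def intro!: holomorphic_intros)
  have eD: "exp (D w) = 1" if "w \<in> ball 0 1" for w
    using L(3)[OF that] M(3)[OF that] by (metis D_def exp_diff exp_not_eq_zero divide_self)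
  have "(D has_field_derivative 0) (at w within ball 0 1)" if w: "w \<in> ball 0 1" for w
  proof -
    have d: "(D has_field_derivative deriv D w) (at w)"
      by (rule holomorphic_derivI[OF D(1) _ w]) simp
    have "((\<lambda>w. exp (D w)) has_field_derivative exp (D w) * deriv D w) (at w)"
      by (rule derivative_eq_intros d)+ simp
    moreover have "((\<lambda>w. exp (D w)) has_field_derivative 0) (at w)"
      by (rule has_field_derivative_transform_within_open[of "\<lambda>_. 1" _ _ "ball 0 1"])
         (use w eD in auto)
    ultimately have "exp (D w) * deriv D w = 0" by (rule DERIV_unique)
    then show ?thesis using d by (simp add: has_field_derivative_at_within)
  qed
  then have "D z = D 0"
    using has_field_derivative_zero_constant[of "ball 0 1" D] z by force
  then show ?thesis using D(2) by (simp add: D_def)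
qed


section \<open>The extremal function\<close>

definition extremal_quadratic :: "real \<Rightarrow> complex \<Rightarrow> complex" where
  "extremal_quadratic p z = 1 + of_real (sqrt (2*p / (2 - p))) * z + of_real (p / (2 - p)) * z\<^sup>2"

definition extremal_fun :: "real \<Rightarrow> complex \<Rightarrow> complex" where
  "extremal_fun p z =
     of_real ((1 - p/2) powr (2/p)) * disc_power (extremal_quadratic p) (2/p) z"

lemma extremal_quadratic_nonzero:
  assumes p: "0 < p" "p < 1" and z: "z \<in> ball 0 1"
  shows "extremal_quadratic p z \<noteq> 0"
proof
  assume eq: "extremal_quadratic p z = 0"
  define c where "c = p / (2 - p)"
  define b where "b = sqrt (2*p / (2 - p))"
  define x y where "x = Re z" and "y = Im z"
  have c: "0 < c" "c < 1" using p by (auto simp: c_def field_simps)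
  have b2: "b^2 = 2*c" using p by (simp add: b_def c_def)
  have zz: "x^2 + y^2 < 1"
    using z by (simp add: x_def y_def cmod_def)
  have re: "1 + b*x + c*(x^2 - y^2) = 0" and im: "b*y + 2*c*x*y = 0"
    using eq unfolding extremal_quadratic_def b_def[symmetric] c_def[symmetric]
    by (auto simp: complex_eq_iff x_def y_def power2_eq_square algebra_simps)
  show False
  proof (cases "y = 0")
    case True
    then have "2*(1 + b*x + c*x^2) = (1 + b*x)^2 + 1"
      using b2 by (simp add: power2_eq_square algebra_simps)
    with re True have "(1 + b*x)^2 + 1 = 0" by simp
    then show False by (smt (verit) zero_le_power2)
  next
    case False
    have "y * (b + 2*c*x) = 0" using im by (simp add: algebra_simps)
    with False have bx: "b = - 2*c*x" by simp
    have "1 = c*(x^2 + y^2)"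
      using re unfolding bx by (simp add: power2_eq_square algebra_simps)
    also have "\<dots> < c * 1" using zz c by (intro mult_strict_left_mono) auto
    finally show False using c by simp
  qed
qed

end

theory Submission
  imports Defs
begin

text \<open>
  Put \<open>m = 2/p - 1\<close>, so \<open>m > 1\<close>. The proof turns the coefficient problem into an extremal problem
  in finitely many variables.

  Let \<open>r < 1\<close> be such that \<open>f\<close> has no zero of modulus \<open>r\<close>, and let \<open>M\<close> be the \<open>p\<close>-th power mean of
  \<open>f\<close> on that circle. Dividing \<open>f (r z)\<close> by the finite Blaschke product \<open>B\<close> of its zeros in the disc
  leaves a zero-free function, whose power \<open>p/2\<close> is \<open>M\<^sup>1\<^sup>/\<^sup>2 g\<close> with \<open>g\<close> of quadratic mean \<open>1\<close> on the
  circle. With \<open>h = B g\<close> this reads \<open>f (r z) = M\<^sup>1\<^sup>/\<^sup>p h g\<^sup>m\<close> (\<open>normalised_factorization\<close>), and \<open>h\<close>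
  also has quadratic mean \<open>1\<close>, because \<open>B\<close> has modulus \<open>1\<close> on the circle. The second coefficient of
  \<open>h g\<^sup>m\<close> is an explicit expression in \<open>x = g 0 > 0\<close>, in \<open>\<mu> = B 0\<close> and in the first and second
  coefficients of \<open>g\<close> and \<open>h\<close> (\<open>taylor_coeff_2_product\<close>). Bessel's inequality for \<open>g\<close> and \<open>h\<close> and
  \<open>\<bar>\<mu>\<bar> \<le> 1\<close> are the only constraints that are used.

  This finite problem is solved by \<open>coeff_functional_moduli_bound\<close>. Young's inequality, with weights
  that depend on \<open>\<bar>\<mu>\<bar>\<close>, bounds the expression by \<open>x\<^sup>m\<^sup>-\<^sup>1 (A - D x\<^sup>2) / 2\<close>. Its maximum over \<open>x\<close> is
  elementary, and \<open>majorant_ratios\<close> shows that this maximum is largest for \<open>\<bar>\<mu>\<bar> = 1\<close> only, that is,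
  for functions without zeros. Letting \<open>r\<close> tend to \<open>1\<close> gives the bound for \<open>f\<close>.

  For uniqueness, let \<open>f\<close> attain the bound and let \<open>r\<close> tend to \<open>1\<close>. The coefficient data of the
  factorisations stay in a compact set, and a limit point maximises the finite problem. At a maximum
  the coefficients of index \<open>0, 1, 2\<close> exhaust the norm of \<open>g\<close>, so by Bessel all later coefficients tend
  to \<open>0\<close> and \<open>g\<close> converges to a rotation of the extremal quadratic. Since \<open>\<bar>h\<bar> \<le> \<bar>g\<bar>\<close>, this
  gives \<open>\<bar>f\<bar> \<le> \<bar>E\<bar>\<close> on the disc for a rotation \<open>E\<close> of the extremal function, with equality at \<open>0\<close>,
  and the maximum principle for \<open>f / E\<close> ends the proof (\<open>extremal_unique\<close>).
\<close>

section \<open>The extremal problem for the coefficients\<close>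

text \<open>
  This is \<open>(1 - y) powr (-E) \<ge> 1 + E y + E (E+1) y\<^sup>2 / 2\<close>: all coefficients of the binomial series
  on the left are nonnegative.
\<close>

lemma ln_binomial_quadratic_le:
  fixes E y :: real
  assumes "E > 0" "0 \<le> y" "y < 1"
  shows "ln (1 + E*y + E*(E+1)/2*y^2) \<le> - E * ln (1 - y)"
proof -
  define F where "F = (\<lambda>y::real. - E * ln (1 - y) - ln (1 + E*y + E*(E+1)/2*y^2))"
  have pos: "1 + E*t + E*(E+1)/2*t^2 > 0" if "0 \<le> t" for t
    using that assms by (smt (verit) divide_nonneg_pos mult_nonneg_nonneg zero_le_power2)
  have "F 0 \<le> F y"
  proof (rule DERIV_nonneg_imp_nondecreasing[OF assms(2)])
    fix t assume t: "0 \<le> t" "t \<le> y"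
    define q where "q = 1 + E*t + E*(E+1)/2*t^2"
    have q: "q > 0" using pos t by (simp add: q_def)
    have t1: "1 - t > 0" using t assms by simp
    have "(F has_real_derivative (E / (1 - t) - (E + E*(E+1)*t) / q)) (at t)"
      unfolding F_def q_def
      by (rule derivative_eq_intros refl | use t1 q[unfolded q_def] in simp)+
    moreover have "E / (1 - t) - (E + E*(E+1)*t) / q = E*(E+1)*(E/2+1)*t^2 / ((1-t)*q)"
      using t1 q by (simp add: divide_simps) (simp add: q_def power2_eq_square algebra_simps)
    moreover have "E*(E+1)*(E/2+1)*t^2 / ((1-t)*q) \<ge> 0"
      using t1 q assms by simp
    ultimately show "\<exists>d. (F has_real_derivative d) (at t) \<and> 0 \<le> d" by force
  qed
  then show ?thesis by (simp add: F_def)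
qed

text \<open>
  For \<open>l = \<bar>\<mu>\<bar>\<close> the expression to be maximised is at most \<open>x\<^sup>m\<^sup>-\<^sup>1 (A - D x\<^sup>2) / 2\<close>, where \<open>v\<close> is the
  weight in Young's inequality and \<open>\<alpha>\<close>, \<open>\<delta>\<close> are the ratios of \<open>A\<close>, \<open>D\<close> to their values at \<open>l = 1\<close>.
  The maximum over \<open>x\<close> is proportional to \<open>\<alpha>\<^bsup>(m+1)/2\<^esup> \<delta>\<^bsup>-(m-1)/2\<^esup>\<close>, so the point is
  \<open>\<alpha>\<^bsup>m+1\<^esup> \<le> \<delta>\<^bsup>m-1\<^esup>\<close>. Both sides have the same derivative at \<open>l = 1\<close>. Therefore the binomial power
  \<open>\<alpha>\<^bsup>(m+1)/(m-1)\<^esup>\<close> has to be estimated correctly up to second order; after that a polynomial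
  inequality in \<open>\<tau>\<close> remains, which has a double zero at \<open>\<tau> = 0\<close>.
\<close>

lemma majorant_ratios:
  fixes m l :: real
  assumes m: "m > 1" and l: "0 \<le> l" "l \<le> 1"
  defines "v \<equiv> l + m * (1 - l)"
  defines "\<alpha> \<equiv> (m + 1/v) / (m + 1)"
    and "\<delta> \<equiv> (m^2*l^2/v + m^3 - v - l^2*m) / ((m+1)^2*(m-1))"
  shows "v > 0" "0 < \<alpha>" "0 < \<delta>" "(m+1) * ln \<alpha> \<le> (m-1) * ln \<delta>"
    "(m+1) * ln \<alpha> = (m-1) * ln \<delta> \<Longrightarrow> l = 1"
proof -
  have v1: "v - 1 = (m - 1) * (1 - l)" by (simp add: v_def algebra_simps)
  have vm: "m - v = l * (m - 1)" by (simp add: v_def algebra_simps)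
  have v: "v \<ge> 1" using v1 m l by (smt (verit) mult_nonneg_nonneg)
  have vm': "v \<le> m" using vm m l by (smt (verit) mult_nonneg_nonneg)
  show v0: "v > 0" using v by simp
  show a0: "0 < \<alpha>" using v0 m by (simp add: \<alpha>_def add_pos_pos)
  \<comment> \<open>\<open>\<tau>\<close> runs through \<open>[0, 1/m]\<close>, and \<open>\<alpha> = 1 - \<tau> / E\<close> for \<open>E = (m+1)/(m-1)\<close>.\<close>
  define \<tau> where "\<tau> = (1 - 1/v) / (m - 1)"
  have t0: "\<tau> \<ge> 0" using v m by (simp add: \<tau>_def)
  have tm: "1 - m * \<tau> = l / v" using v0 m
    by (simp add: \<tau>_def v_def divide_simps) (simp add: algebra_simps)
  then have tm0: "1 - m*\<tau> \<ge> 0" using l v0 by (smt (verit) divide_nonneg_pos)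
  have n: "1 - (m-1)*\<tau> = 1/v" using m by (simp add: \<tau>_def)
  \<comment> \<open>\<open>1 / W\<close> is the bound for \<open>\<alpha> powr E\<close> that comes from the quadratic part of the binomial series.\<close>
  define W where "W = 1 + \<tau> + m*\<tau>^2/(m+1)"
  have W: "W \<ge> 1" using t0 m by (simp add: W_def)
  define q where "q = (m+1)*(1-(m-1)*\<tau>) + m^3*\<tau>^2*(1-m*\<tau>)"
  have q: "q > 0" unfolding q_def n using tm0 v0 m
    by (intro add_pos_nonneg) auto
  have key0: "(m^3*(1-(m-1)*\<tau>)^2 - (1-(m-1)*\<tau>) + m*(m-1)*(1-m*\<tau>)^3) * (m+1+(m+1)*\<tau>+m*\<tau>^2)
       - (m+1)^3*(m-1)*(1-(m-1)*\<tau>)^2 = (m-1)*m*\<tau>^2*q"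
    unfolding q_def by algebra
  have D: "\<delta> * ((m+1)^2*(m-1)) = (m^3*(1/v)^2 - (1/v) + m*(m-1)*(1-m*\<tau>)^3) * v^2"
  proof -
    have "\<delta> * ((m+1)^2*(m-1)) = m^2*l^2/v + m^3 - v - l^2*m"
      using m by (simp add: \<delta>_def)
    also have "\<dots> = m^3 - v + l^2*m*(m/v - 1)" by (simp add: power2_eq_square algebra_simps)
    also have "m/v - 1 = (m-v)/v" using v0 by (simp add: diff_divide_distrib)
    also have "\<dots> = (m-1)*(l/v)" unfolding vm by simp
    also have "m^3 - v + l^2*m*((m-1)*(l/v)) = (m^3*(1/v)^2 - (1/v) + m*(m-1)*(l/v)^3) * v^2"
      using v0 by (simp add: divide_simps power2_eq_square power3_eq_cube algebra_simps)
    finally show ?thesis using tm by simp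
  qed
  have DW: "\<delta> * W - 1 = m*\<tau>^2*q * v^2 / (m+1)^3"
  proof -
    have "((m+1)^2*(m-1)*(m+1)) * (\<delta> * W) = (\<delta> * ((m+1)^2*(m-1))) * (m+1+(m+1)*\<tau>+m*\<tau>^2)"
      using m by (simp add: W_def divide_simps) (simp add: algebra_simps)
    also have "\<dots> = v^2 * ((m^3*(1/v)^2 - (1/v) + m*(m-1)*(1-m*\<tau>)^3) * (m+1+(m+1)*\<tau>+m*\<tau>^2))"
      unfolding D by (simp add: algebra_simps)
    also have "\<dots> = v^2 * ((m-1)*m*\<tau>^2*q + (m+1)^3*(m-1)*(1/v)^2)"
      using key0 unfolding n by (simp only: diff_eq_eq)
    also have "\<dots> = (m-1)*m*\<tau>^2*q * v^2 + (m+1)^3*(m-1)"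
      using v0 by (simp add: power_divide algebra_simps)
    finally have *: "((m+1)^3*(m-1)) * (\<delta> * W) = (m-1)*m*\<tau>^2*q * v^2 + (m+1)^3*(m-1)"
      by (simp add: power2_eq_square power3_eq_cube algebra_simps)
    have c: "m + 1 \<noteq> 0" "m \<noteq> 1" using m by auto
    have "((m+1)^3*(m-1)) * (\<delta> * W - 1) = (m-1)*m*\<tau>^2*q * v^2"
      using * by (simp only: right_diff_distrib) simp
    then show ?thesis using c by (auto simp: eq_divide_eq mult_ac)
  qed
  have DW1: "\<delta> * W \<ge> 1" using DW q m v0 by (smt (verit) divide_nonneg_pos mult_nonneg_nonneg zero_le_power2 zero_less_power)
  then show d0: "0 < \<delta>" using W by (smt (verit) mult_nonpos_nonneg)
  define E where "E = (m+1)/(m-1)"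
  have E: "E > 0" using m by (simp add: E_def)
  have ya: "1 - \<tau>/E = \<alpha>" using m v0
    by (simp add: \<alpha>_def \<tau>_def E_def divide_simps) (simp add: algebra_simps)
  have EW: "1 + E*(\<tau>/E) + E*(E+1)/2*(\<tau>/E)^2 = W"
  proof -
    have "E*(E+1)/2*(\<tau>/E)^2 = (1 + 1/E)/2*\<tau>^2"
      using E by (simp add: divide_simps power2_eq_square)
    also have "(1 + 1/E)/2 = m/(m+1)" using m by (simp add: E_def divide_simps)
    finally have "E*(E+1)/2*(\<tau>/E)^2 = m/(m+1)*\<tau>^2" .
    moreover have "E*(\<tau>/E) = \<tau>" using E by simp
    moreover have "W = 1 + \<tau> + m/(m+1)*\<tau>^2" by (simp add: W_def)
    ultimately show ?thesis by (simp only:)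
  qed
  have lw: "ln W \<le> - E * ln \<alpha>"
  proof -
    have "0 \<le> \<tau>/E" using E t0 by simp
    moreover have "\<tau>/E < 1" using ya a0 by linarith
    ultimately show ?thesis using ln_binomial_quadratic_le[of E "\<tau>/E"] E unfolding ya EW by simp
  qed
  then have lw2: "(m+1) * ln \<alpha> \<le> - ((m-1) * ln W)"
  proof -
    have "(m-1) * ln W \<le> (m-1) * (- E * ln \<alpha>)" using lw m by (intro mult_left_mono) auto
    also have "\<dots> = - ((m+1) * ln \<alpha>)" using m by (simp add: E_def)
    finally show ?thesis by simp
  qed
  have sum: "ln (\<delta> * W) = ln \<delta> + ln W" using d0 W by (simp add: ln_mult)
  have sum2: "(m-1) * ln (\<delta>*W) = (m-1) * ln \<delta> + (m-1) * ln W"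
    unfolding sum by (rule distrib_left)
  have "0 \<le> (m-1) * ln (\<delta>*W)" using DW1 m by simp
  then show "(m+1) * ln \<alpha> \<le> (m-1) * ln \<delta>" using lw2 sum2 by simp
  show "l = 1" if eq: "(m+1) * ln \<alpha> = (m-1) * ln \<delta>"
  proof -
    have "(m-1) * ln (\<delta>*W) \<le> 0" using eq lw2 sum2 by simp
    then have "ln (\<delta>*W) \<le> 0" using m by (simp add: mult_le_0_iff)
    then have "\<delta>*W - 1 = 0" using DW1 by (smt (verit) ln_gt_zero)
    then have "m*\<tau>^2*q * v^2 = 0" using DW m by simp
    then have "\<tau> = 0" using m q v0 by simp
    then have "v = 1" using v0 m by (simp add: \<tau>_def)
    then show ?thesis using v1 m by simp
  qed
qed

text \<open>
  The sharp constant, \<open>2/p (1 - p/2)\<^bsup>2/p-1\<^esup>\<close> for \<open>m = 2/p - 1\<close>, in the form in which the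
  maximisation produces it.
\<close>

definition extremal_value :: "real \<Rightarrow> real" where
  "extremal_value m = m * (m / (m + 1)) powr (m - 1)"

text \<open>
  Weighted arithmetic-geometric mean inequality, in logarithmic form: the logarithm of the left hand
  side splits into three parts, one that depends on \<open>\<alpha>\<close> and \<open>\<delta>\<close> alone and two that are bounded by
  \<open>ln y \<le> y - 1\<close>. The two gaps are kept, as they decide the case of equality.
\<close>

lemma majorant_max:
  fixes m x \<alpha> \<delta> :: real
  assumes m: "m > 1" and x: "x > 0" and a: "\<alpha> > 0" and d: "\<delta> > 0"
    and le: "(m+1) * ln \<alpha> \<le> (m-1) * ln \<delta>"
  defines "R \<equiv> m*(m+1)*\<alpha> - (m+1)^2*(m-1)/m * \<delta> * x^2"
  shows "x powr (m-1) * (R/2) \<le> extremal_value m"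
    "x powr (m-1) * (R/2) = extremal_value m \<Longrightarrow>
      (m+1) * ln \<alpha> = (m-1) * ln \<delta> \<and> x^2 * \<delta> = (m/(m+1))^2 * \<alpha>"
proof -
  \<comment> \<open>Normalised so that the maximum over \<open>x\<close> is at \<open>y = 1\<close>.\<close>
  define y where "y = x^2 * (\<delta>/\<alpha>) * ((m+1)/m)^2"
  have y: "y > 0" using assms(1-4) by (simp add: y_def)
  define \<epsilon> where "\<epsilon> = (m-1)/(m+1)"
  have R: "R = m*(m+1)*\<alpha>*(1 - \<epsilon>*y)"
    using m a unfolding R_def \<epsilon>_def y_def
    by (simp add: divide_simps) (simp add: power2_eq_square algebra_simps)
  have Kp: "extremal_value m > 0" using m by (simp add: extremal_value_def)
  have main: "x powr (m-1) * (R/2) \<le> extremal_value m \<and> (x powr (m-1) * (R/2) = extremal_value m \<longrightarrow>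
      (m+1) * ln \<alpha> = (m-1) * ln \<delta> \<and> y = 1)"
  proof (cases "R > 0")
    case False
    then have "x powr (m-1) * (R/2) \<le> 0" using x by (simp add: mult_nonneg_nonpos)
    then show ?thesis using Kp by linarith
  next
    case True
    moreover have "m*(m+1)*\<alpha> > 0" using m a by simp
    ultimately have e: "1 - \<epsilon>*y > 0" unfolding R by (simp only: zero_less_mult_pos)
    have e1: "ln (1-\<epsilon>*y) \<le> ln (2/(m+1)) + (m-1)/2*(1-y)"
    proof -
      have "ln ((1-\<epsilon>*y) / (2/(m+1))) \<le> (1-\<epsilon>*y)/(2/(m+1)) - 1"
        using e m by (intro ln_le_minus_one) simp
      also have "\<dots> = (m-1)/2*(1-y)" using m by (simp add: \<epsilon>_def divide_simps) (simp add: algebra_simps)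
      finally have "ln ((1-\<epsilon>*y) / (2/(m+1))) \<le> (m-1)/2*(1-y)" .
      moreover have "ln ((1-\<epsilon>*y) / (2/(m+1))) = ln (1-\<epsilon>*y) - ln (2/(m+1))"
        using e m by (intro ln_divide_pos) auto
      ultimately show ?thesis by linarith
    qed
    have e2: "ln y \<le> y - 1" using y by (rule ln_le_minus_one)
    have lnx: "2 * ln x = ln y + ln \<alpha> - ln \<delta> + 2 * ln (m/(m+1))"
    proof -
      have "x^2 = y * \<alpha> / \<delta> * (m/(m+1))^2"
        using m a d by (simp add: y_def divide_simps)
      moreover have "ln (y * \<alpha> / \<delta> * (m/(m+1))^2) = ln y + ln \<alpha> - ln \<delta> + ln ((m/(m+1))^2)"
        using m a d y by (subst ln_mult ln_div; simp add: ln_mult ln_div)+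
      moreover have "ln ((m/(m+1))^2) = 2 * ln (m/(m+1))" using m by (simp add: ln_realpow)
      moreover have "ln (x^2) = 2 * ln x" using x by (simp add: ln_realpow)
      ultimately show ?thesis by simp
    qed
    have lhs: "ln (x powr (m-1) * (R/2)) = (m-1)/2 * (2 * ln x) + ln (R/2)"
    proof -
      have "ln (x powr (m-1) * (R/2)) = ln (x powr (m-1)) + ln (R/2)"
        using x True by (intro ln_mult_pos) auto
      then show ?thesis using x by (simp add: ln_powr)
    qed
    have lnR: "ln (R/2) = ln (m*(m+1)/2) + ln \<alpha> + ln (1-\<epsilon>*y)"
    proof -
      have "R/2 = m*(m+1)/2*\<alpha>*(1-\<epsilon>*y)" by (simp add: R)
      also have "ln \<dots> = ln (m*(m+1)/2*\<alpha>) + ln (1-\<epsilon>*y)"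
        using m a e by (intro ln_mult_pos) auto
      also have "ln (m*(m+1)/2*\<alpha>) = ln (m*(m+1)/2) + ln \<alpha>"
        using m a by (intro ln_mult_pos) auto
      finally show ?thesis .
    qed
    have lnK: "ln (extremal_value m) = ln (m*(m+1)/2) + ln (2/(m+1)) + (m-1) * ln (m/(m+1))"
    proof -
      have "ln (m*(m+1)/2) + ln (2/(m+1)) = ln (m*(m+1)/2 * (2/(m+1)))"
        using m by (intro ln_mult_pos[symmetric]) auto
      also have "m*(m+1)/2 * (2/(m+1)) = m" using m by (simp add: divide_simps)
      finally have "ln (m*(m+1)/2) + ln (2/(m+1)) = ln m" .
      moreover have "ln (extremal_value m) = ln m + ln ((m/(m+1)) powr (m-1))"
        unfolding extremal_value_def using m by (intro ln_mult_pos) auto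
      moreover have "ln ((m/(m+1)) powr (m-1)) = (m-1) * ln (m/(m+1))"
        using m by (simp add: ln_powr)
      ultimately show ?thesis by linarith
    qed
    define gap where "gap = ((m-1) * ln \<delta> - (m+1) * ln \<alpha>) / 2"
    define gap2 where "gap2 = (m-1)/2 * (y - 1 - ln y)"
    have g: "gap \<ge> 0" using le by (simp add: gap_def)
    have g2: "gap2 \<ge> 0" using e2 m by (simp add: gap2_def)
    have le': "ln (x powr (m-1) * (R/2)) \<le> ln (extremal_value m) - gap - gap2"
      unfolding lhs lnx lnR lnK gap_def gap2_def using e1 by (simp add: field_simps)
    have p: "x powr (m-1) * (R/2) > 0" using x True by simp
    have "x powr (m-1) * (R/2) \<le> extremal_value m"
    proof -
      have "ln (x powr (m-1) * (R/2)) \<le> ln (extremal_value m)" using le' g g2 by linarith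
      then show ?thesis by (simp only: ln_le_cancel_iff[OF p Kp])
    qed
    moreover have "(m+1) * ln \<alpha> = (m-1) * ln \<delta> \<and> y = 1"
      if "x powr (m-1) * (R/2) = extremal_value m"
    proof -
      have "gap = 0" "gap2 = 0" using le' g g2 unfolding that by linarith+
      then have "(m+1) * ln \<alpha> = (m-1) * ln \<delta>" "ln y = y - 1"
        using m by (simp_all add: gap_def gap2_def)
      then show ?thesis using ln_eq_minus_one[OF y] by simp
    qed
    ultimately show ?thesis by blast
  qed
  then show "x powr (m-1) * (R/2) \<le> extremal_value m" by blast
  show "(m+1) * ln \<alpha> = (m-1) * ln \<delta> \<and> x^2 * \<delta> = (m/(m+1))^2 * \<alpha>"
    if "x powr (m-1) * (R/2) = extremal_value m"
  proof -
    have "y = 1" using main that by blast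
    then have "x^2 * \<delta> = (m/(m+1))^2 * \<alpha>" using m a
      by (simp add: y_def divide_simps)
    then show ?thesis using main that by blast
  qed
qed

lemma weighted_young:
  fixes a b c :: real assumes "c > 0"
  shows "a * b \<le> (a^2/c + c*b^2)/2" "a * b = (a^2/c + c*b^2)/2 \<Longrightarrow> a = c * b"
proof -
  have *: "(a^2/c + c*b^2)/2 - a*b = (a - c*b)^2 / (2*c)"
    using assms by (simp add: divide_simps power2_eq_square) (simp add: algebra_simps)
  have "(a - c*b)^2 / (2*c) \<ge> 0" using assms by simp
  with * show "a * b \<le> (a^2/c + c*b^2)/2" by linarith
  assume "a * b = (a^2/c + c*b^2)/2"
  with * have "(a - c*b)^2 / (2*c) = 0" by simp
  then show "a = c*b" using assms by simp
qed

text \<open>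
  The extremal problem for the moduli \<open>B1, B2\<close> and \<open>C1, C2\<close> of the coefficients of \<open>g\<close> and \<open>h\<close>.
  The constraints become applicable when \<open>B1\<^sup>2\<close> and \<open>B2\<^sup>2\<close> enter the Young bounds with one common
  factor, and \<open>C1\<^sup>2\<close> and \<open>C2\<^sup>2\<close> with another. The choice \<open>v + l (m - 1) = m\<close> makes the first factor
  \<open>m\<^sup>2/2\<close> for every \<open>l\<close>; the weight \<open>m/v\<close> for \<open>x C2\<close> makes the second \<open>m/(2 v)\<close>.
\<close>

lemma coeff_functional_moduli_bound:
  fixes m x l B1 B2 C1 C2 :: real
  assumes m: "m > 1" and x: "0 < x" and l: "0 \<le> l" "l \<le> 1"
    and B: "x^2 + B1^2 + B2^2 \<le> 1" and C: "(l*x)^2 + C1^2 + C2^2 \<le> 1"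
  defines "T \<equiv> x powr (m-1) * (x*C2 + m*(C1*B1) + m*(l*(x*B2 + (m-1)/2*B1^2)))"
  shows "T \<le> extremal_value m"
    "T = extremal_value m \<Longrightarrow>
       l = 1 \<and> x = m/(m+1) \<and> x = m*C2 \<and> C1 = B1 \<and> x = m*B2 \<and> x^2 + B1^2 + B2^2 = 1"
proof -
  define v where "v = l + m*(1-l)"
  define \<alpha> where "\<alpha> = (m + 1/v) / (m + 1)"
  define \<delta> where "\<delta> = (m^2*l^2/v + m^3 - v - l^2*m) / ((m+1)^2*(m-1))"
  note ad = majorant_ratios[OF m l, folded v_def, folded \<alpha>_def \<delta>_def]
  have v: "v > 0" by (rule ad)
  define R where "R = m*(m+1)*\<alpha> - (m+1)^2*(m-1)/m * \<delta> * x^2"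
  have R: "R = m/v * (1-(l*x)^2) + m^2*(1-x^2) + x^2 * v/m + (l*x)^2"
  proof -
    have r1: "(m+1)^2*(m-1)/m * \<delta> = (m^2*l^2/v + m^3 - v - l^2*m)/m"
      using m by (simp add: \<delta>_def)
    have r2: "m*(m+1)*\<alpha> = m*(m+1/v)" using m by (simp add: \<alpha>_def)
    show ?thesis unfolding R_def r1 r2 using m v
      by (simp add: divide_simps) (simp add: power2_eq_square power3_eq_cube algebra_simps)
  qed
  define Q where "Q = x*C2 + m*(C1*B1) + m*(l*(x*B2 + (m-1)/2*B1^2))"
  have c: "m/v > 0" "1/v > 0" "v > 0" "m^2 > 0" using v m by auto
  have y1: "x*C2 \<le> (x^2/(m/v) + m/v * C2^2)/2" by (rule weighted_young) (fact c)
  have y2: "B1*C1 \<le> (B1^2/(1/v) + 1/v * C1^2)/2" by (rule weighted_young) (fact c)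
  have y3: "(m*(l*x))*B2 \<le> ((m*(l*x))^2/m^2 + m^2*B2^2)/2" by (rule weighted_young) (fact c)
  define gC where "gC = 1 - ((l*x)^2 + C1^2 + C2^2)"
  define gB where "gB = 1 - (x^2 + B1^2 + B2^2)"
  define g1 where "g1 = (x^2/(m/v) + m/v * C2^2)/2 - x*C2"
  define g2 where "g2 = (B1^2/(1/v) + 1/v * C1^2)/2 - B1*C1"
  define g3 where "g3 = ((m*(l*x))^2/m^2 + m^2*B2^2)/2 - (m*(l*x))*B2"
  have id: "R/2 - Q = m/v/2*gC + m^2/2*gB + g1 + m*g2 + g3"
  proof -
    have l': "m * l * (m-1) = m * (m - v)" by (simp add: v_def algebra_simps)
    have "Q = x*C2 + m*(C1*B1) + m*(l*x)*B2 + (m*l*(m-1))/2*B1^2"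
      by (simp add: Q_def algebra_simps)
    then have Q': "Q = x*C2 + m*(C1*B1) + m*(l*x)*B2 + m*(m-v)/2*B1^2"
      unfolding l' .
    have g3': "g3 = ((l*x)^2 + m^2*B2^2)/2 - (m*(l*x))*B2"
      using m by (simp add: g3_def power_mult_distrib)
    show ?thesis unfolding R Q' gC_def gB_def g1_def g2_def g3'
      using v m by (simp add: field_simps power2_eq_square)
  qed
  have nn: "m/v/2*gC \<ge> 0" "m^2/2*gB \<ge> 0" "g1 \<ge> 0" "m*g2 \<ge> 0" "g3 \<ge> 0"
    using B C y1 y2 y3 m v by (auto simp: gC_def gB_def g1_def g2_def g3_def)
  have QR: "Q \<le> R/2" using id nn by linarith
  have xp: "x powr (m-1) > 0" using x by simp
  have TQ: "T = x powr (m-1) * Q" by (simp add: T_def Q_def)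
  have TR: "T \<le> x powr (m-1) * (R/2)" unfolding TQ using QR xp by (intro mult_left_mono) auto
  note qm = majorant_max[OF m x ad(2) ad(3) ad(4), folded R_def]
  show "T \<le> extremal_value m" using TR qm(1) by linarith
  assume "T = extremal_value m"
  then have eq: "x powr (m-1) * (R/2) = extremal_value m" and "T = x powr (m-1) * (R/2)"
    using TR qm(1) by linarith+
  then have "x powr (m-1) * Q = x powr (m-1) * (R/2)" unfolding TQ by (simp only:)
  then have "Q = R/2" using xp by (simp only: mult_cancel_left) auto
  then have z: "m/v/2*gC = 0" "m^2/2*gB = 0" "g1 = 0" "m*g2 = 0" "g3 = 0"
    using id nn by linarith+
  have l1: "l = 1" using qm(2)[OF eq] ad(5) by blast
  then have v1: "v = 1" by (simp add: v_def)
  have a1: "\<alpha> = 1" using m by (simp add: \<alpha>_def v1)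
  have d1: "\<delta> = 1" using m by (simp add: \<delta>_def v1 l1 divide_simps) (simp add: power2_eq_square power3_eq_cube algebra_simps)
  have "x^2 = (m/(m+1))^2" using qm(2)[OF eq] a1 d1 by simp
  then have "x = m/(m+1)" using x m by (subst (asm) power2_eq_iff_nonneg) auto
  moreover have "x = m*C2" using weighted_young(2)[OF c(1), of x C2] z v1 by (simp add: g1_def)
  moreover have "C1 = B1" using weighted_young(2)[OF c(2), of B1 C1] z m v1 by (simp add: g2_def)
  moreover have "m*x = m^2*B2" using weighted_young(2)[OF c(4), of "m*(l*x)" B2] z l1 by (simp add: g3_def)
  then have "x = m*B2" using m by (simp add: power2_eq_square)
  moreover have "x^2 + B1^2 + B2^2 = 1" using z m by (simp add: gB_def)
  ultimately show "l = 1 \<and> x = m/(m+1) \<and> x = m*C2 \<and> C1 = B1 \<and> x = m*B2 \<and> x^2 + B1^2 + B2^2 = 1"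
    using l1 by simp
qed

text \<open>
  The second Taylor coefficient of \<open>h g\<^sup>m\<close> when \<open>g\<close> has the coefficients \<open>x, b1, b2\<close> and \<open>h\<close> the
  coefficients \<open>\<mu> x, c1, c2\<close>. Writing the constant term of \<open>h\<close> as \<open>\<mu> x\<close> leaves only the positive power
  \<open>m - 1\<close> of \<open>x\<close>, and so the functional is continuous up to \<open>x = 0\<close>.
\<close>

definition coeff_functional ::
    "real \<Rightarrow> real \<Rightarrow> complex \<Rightarrow> complex \<Rightarrow> complex \<Rightarrow> complex \<Rightarrow> complex \<Rightarrow> complex" where
  "coeff_functional m x \<mu> b1 b2 c1 c2 = of_real (x powr (m-1)) *
     (of_real x * c2 + of_real m * (c1*b1) + of_real m * (\<mu> * (of_real x * b2 + of_real ((m-1)/2) * b1^2)))"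

lemma eq_cmod_of_Re:
  assumes "Re z = cmod z"
  shows "z = of_real (cmod z)"
proof -
  have "(Im z)^2 = 0" using cmod_power2[of z] assms by simp
  then show ?thesis using assms by (simp add: complex_eq_iff)
qed

text \<open>
  Equality forces every product in the functional to be a nonnegative real number. The argument
  \<open>\<theta>\<close> of \<open>b1\<close> then fixes \<open>\<mu> = cis (-2 \<theta>)\<close>, and with it the argument of \<open>b2\<close>.
\<close>

lemma coeff_functional_bound:
  fixes m x :: real and \<mu> b1 b2 c1 c2 :: complex
  assumes m: "m > 1" and x: "0 \<le> x" and l: "cmod \<mu> \<le> 1"
    and B: "x^2 + (cmod b1)^2 + (cmod b2)^2 \<le> 1"
    and C: "(cmod \<mu> * x)^2 + (cmod c1)^2 + (cmod c2)^2 \<le> 1"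
  shows "Re (coeff_functional m x \<mu> b1 b2 c1 c2) \<le> extremal_value m"
    "Re (coeff_functional m x \<mu> b1 b2 c1 c2) = extremal_value m \<Longrightarrow>
      x = m/(m+1) \<and> cmod \<mu> = 1 \<and>
      (\<exists>\<theta>. b1 = of_real (sqrt (2*m)/(m+1)) * cis \<theta> \<and> b2 = of_real (1/(m+1)) * cis (2*\<theta>))"
proof -
  define Q where "Q = of_real x * c2 + of_real m * (c1*b1) + of_real m * (\<mu> * (of_real x * b2 + of_real ((m-1)/2) * b1^2))"
  define q where "q = x * cmod c2 + m * (cmod c1 * cmod b1) + m * (cmod \<mu> * (x * cmod b2 + (m-1)/2 * (cmod b1)^2))"
  have Re_eq: "Re (coeff_functional m x \<mu> b1 b2 c1 c2) = x powr (m-1) * Re Q"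
    by (simp add: coeff_functional_def Q_def)
  define g1 where "g1 = x * (cmod c2 - Re c2)"
  define g2 where "g2 = m * (cmod (c1*b1) - Re (c1*b1))"
  define g3 where "g3 = m * (x * (cmod (\<mu>*b2) - Re (\<mu>*b2)))"
  define g4 where "g4 = m * ((m-1)/2 * (cmod (\<mu>*b1^2) - Re (\<mu>*b1^2)))"
  have Q2: "Q = of_real x * c2 + of_real m * (c1*b1) + of_real m * (of_real x * (\<mu>*b2) + of_real ((m-1)/2) * (\<mu>*b1^2))"
    by (simp add: Q_def algebra_simps)
  have q2: "q = x * cmod c2 + m * cmod (c1*b1) + m * (x * cmod (\<mu>*b2) + (m-1)/2 * cmod (\<mu>*b1^2))"
    by (simp add: q_def norm_mult norm_power algebra_simps)
  have RQ: "Re Q = x * Re c2 + m * Re (c1*b1) + m * (x * Re (\<mu>*b2) + (m-1)/2 * Re (\<mu>*b1^2))"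
    unfolding Q2 by (simp only: plus_complex.simps Re_complex_of_real Im_complex_of_real times_complex.simps mult_zero_left diff_zero)
  have gap: "q - Re Q = g1 + g2 + g3 + g4"
    unfolding RQ q2 g1_def g2_def g3_def g4_def by (simp only: algebra_simps)
  have d: "cmod z - Re z \<ge> 0" for z by (simp add: complex_Re_le_cmod)
  have nn: "g1 \<ge> 0" "g2 \<ge> 0" "g3 \<ge> 0" "g4 \<ge> 0"
    unfolding g1_def g2_def g3_def g4_def
    by (intro mult_nonneg_nonneg d; use x m in simp)+
  have Kp: "extremal_value m > 0" using m by (simp add: extremal_value_def)
  have main: "Re (coeff_functional m x \<mu> b1 b2 c1 c2) \<le> x powr (m-1) * q"
    unfolding Re_eq using gap nn by (intro mult_left_mono) auto
  show "Re (coeff_functional m x \<mu> b1 b2 c1 c2) \<le> extremal_value m"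
  proof (cases "x = 0")
    case True then show ?thesis using Kp unfolding Re_eq by simp
  next
    case False
    then have "x > 0" using x by simp
    from coeff_functional_moduli_bound(1)[OF m this norm_ge_zero l B C] main
    show ?thesis unfolding q_def by linarith
  qed
  assume eq: "Re (coeff_functional m x \<mu> b1 b2 c1 c2) = extremal_value m"
  have x0: "x > 0"
  proof (rule ccontr)
    assume "\<not> x > 0" then have "x = 0" using x by simp
    then show False using eq Kp unfolding Re_eq by simp
  qed
  have T: "x powr (m-1) * q \<le> extremal_value m"
    unfolding q_def by (rule coeff_functional_moduli_bound(1)[OF m x0 norm_ge_zero l B C])
  then have T': "x powr (m-1) * q = extremal_value m" using main eq by linarith
  note r = coeff_functional_moduli_bound(2)[OF m x0 norm_ge_zero l B C, folded q_def, OF T']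
  have "x powr (m-1) * Re Q = x powr (m-1) * q" using eq T' Re_eq by linarith
  then have "Re Q = q" using x0 by (simp only: mult_cancel_left) auto
  then have z: "g3 = 0" "g4 = 0" using gap nn by linarith+
  have lb2: "\<mu>*b2 = of_real (cmod (\<mu>*b2))"
    by (rule eq_cmod_of_Re) (use z x0 m in \<open>simp add: g3_def\<close>)
  have lb1: "\<mu>*b1^2 = of_real (cmod (\<mu>*b1^2))"
    by (rule eq_cmod_of_Re) (use z x0 m in \<open>simp add: g4_def\<close>)
  have l1: "cmod \<mu> = 1" and xm: "x = m/(m+1)" using r by auto
  have "m * cmod b2 = m * (1/(m+1))" using r by simp
  then have nb2: "cmod b2 = 1/(m+1)" using m by (simp only: mult_cancel_left) auto
  have nb1: "cmod b1 = sqrt (2*m)/(m+1)"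
  proof -
    have "(cmod b1)^2 = 1 - (m/(m+1))^2 - (1/(m+1))^2"
    proof -
      have "x^2 + (cmod b1)^2 + (cmod b2)^2 = 1" using r by blast
      then show ?thesis unfolding xm nb2 by linarith
    qed
    also have "\<dots> = (sqrt (2*m)/(m+1))^2" using m
      by (simp add: power_divide divide_simps) (simp add: power2_eq_square algebra_simps)
    finally show ?thesis using m by (subst (asm) power2_eq_iff_nonneg) auto
  qed
  define \<theta> where "\<theta> = Arg b1"
  have b1: "b1 = of_real (cmod b1) * cis \<theta>"
    unfolding \<theta>_def by (metis rcis_cmod_Arg rcis_def)
  have b1p: "cmod b1 > 0" using nb1 m by simp
  have "\<mu> * cis (2*\<theta>) = 1"
  proof -
    have "\<mu> * b1^2 = of_real ((cmod b1)^2) * (\<mu> * cis (2*\<theta>))"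
      by (subst b1) (simp add: power_mult_distrib Complex.DeMoivre)
    moreover have "\<mu> * b1^2 = of_real ((cmod b1)^2)"
      by (subst lb1) (simp add: norm_mult norm_power l1)
    ultimately show ?thesis using b1p by simp
  qed
  then have "b2 = (\<mu> * cis (2*\<theta>)) * b2" by simp
  also have "\<dots> = cis (2*\<theta>) * (\<mu> * b2)" by (simp add: algebra_simps)
  also have "\<dots> = of_real (1/(m+1)) * cis (2*\<theta>)"
    by (subst lb2) (simp add: norm_mult l1 nb2)
  finally have "b2 = of_real (1/(m+1)) * cis (2*\<theta>)" .
  then show "x = m/(m+1) \<and> cmod \<mu> = 1 \<and>
      (\<exists>\<theta>. b1 = of_real (sqrt (2*m)/(m+1)) * cis \<theta> \<and> b2 = of_real (1/(m+1)) * cis (2*\<theta>))"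
    using b1 nb1 xm l1 by auto
qed

section \<open>Taylor coefficients\<close>

lemma taylor_coeff_integral:
  assumes g: "g holomorphic_on ball 0 R" and R: "R > 1"
  shows "((\<lambda>t. g (cis t) * cis (- (of_nat k * t))) has_integral 2*pi*taylor_coeff g k) {0..2*pi}"
proof -
  have sub: "cball 0 1 \<subseteq> ball (0::complex) R" using R by auto
  have "continuous_on (cball 0 1) g"
    using holomorphic_on_imp_continuous_on[OF g] sub continuous_on_subset by blast
  moreover have "g holomorphic_on ball 0 1"
    using g by (rule holomorphic_on_subset) (use R in auto)
  ultimately have "((\<lambda>u. g u / (u-0) ^ (Suc k)) has_contour_integral ((2 * pi * \<i>) / (fact k) * (deriv ^^ k) g 0))
           (circlepath 0 1)"
    by (rule Cauchy_has_contour_integral_higher_derivative_circlepath) simp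
  then have "((\<lambda>t. g (cis t) / cis t ^ Suc k * \<i> * cis t) has_integral ((2 * pi * \<i>) * taylor_coeff g k)) {0..2*pi}"
    unfolding circlepath_def by (subst (asm) has_contour_integral_part_circlepath_iff) (simp_all add: taylor_coeff_def)
  then have "((\<lambda>t. (-\<i>) * (g (cis t) / cis t ^ Suc k * \<i> * cis t)) has_integral (-\<i>) * ((2 * pi * \<i>) * taylor_coeff g k)) {0..2*pi}"
    by (rule has_integral_mult_right)
  moreover have "(-\<i>) * (g (cis t) / cis t ^ Suc k * \<i> * cis t) = g (cis t) * cis (- (of_nat k * t))" for t
  proof -
    have "cis (- (of_nat k * t)) = inverse (cis t ^ k)"
      by (simp add: Complex.DeMoivre)
    then show ?thesis by (simp add: field_simps)
  qed
  moreover have "(-\<i>) * ((2 * pi * \<i>) * taylor_coeff g k) = 2*pi*taylor_coeff g k"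
    by (simp add: algebra_simps)
  ultimately show ?thesis by (simp only:)
qed

lemma taylor_coeff_monomial: "taylor_coeff (\<lambda>z. z ^ n) k = (if k = n then 1 else 0)"
proof -
  have "(deriv ^^ k) (\<lambda>z::complex. z ^ n) 0 = pochhammer (of_nat (Suc n - k)) k * 0 ^ (n - k)"
    using higher_deriv_power[of k 0 n 0] by simp
  moreover have "pochhammer (of_nat (Suc n - k)) k * (0::complex) ^ (n - k) = (if k = n then fact n else 0)"
    by (auto simp: pochhammer_fact pochhammer_0_left power_0_left Suc_diff_le not_le)
  ultimately show ?thesis by (simp add: taylor_coeff_def)
qed

text \<open>
  Integrate \<open>\<bar>g\<bar>\<^sup>2 \<ge> 2 Re (g \<cdot> cnj P) - \<bar>P\<bar>\<^sup>2\<close> over the circle, where \<open>P\<close> is the part of the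
  Taylor series of \<open>g\<close> with indices in \<open>S\<close>; both integrals on the right are known.
\<close>

lemma bessel:
  assumes g: "g holomorphic_on ball 0 R" and R: "R > 1" and S: "finite S"
  shows "(\<Sum>k\<in>S. (cmod (taylor_coeff g k))^2) \<le> integral {0..2*pi} (\<lambda>t. (cmod (g (cis t)))^2 / (2*pi))"
proof -
  define b where "b = taylor_coeff g"
  define s where "s = (\<Sum>k\<in>S. (cmod (b k))^2)"
  define P where "P = (\<lambda>t. \<Sum>k\<in>S. b k * cis t ^ k)"
  have cP: "cnj (P t) = (\<Sum>k\<in>S. cnj (b k) * cis (- (of_nat k * t)))" for t
    by (simp add: P_def cis_cnj Complex.DeMoivre)
  have sq: "cnj z * (2*pi*z) = of_real (2*pi*(cmod z)^2)" for z :: complex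
    by (simp add: complex_norm_square mult_ac del: of_real_power)
  have gP: "((\<lambda>t. g (cis t) * cnj (P t)) has_integral of_real (2*pi * s)) {0..2*pi}"
  proof -
    have "((\<lambda>t. \<Sum>k\<in>S. cnj (b k) * (g (cis t) * cis (- (of_nat k * t)))) has_integral
       (\<Sum>k\<in>S. cnj (b k) * (2*pi*b k))) {0..2*pi}"
      unfolding b_def by (intro has_integral_sum S has_integral_mult_right taylor_coeff_integral[OF g R])
    moreover have "(\<Sum>k\<in>S. cnj (b k) * (2*pi*b k)) = of_real (2*pi * s)"
      by (simp only: sq s_def sum_distrib_left of_real_sum)
    moreover have "(\<Sum>k\<in>S. cnj (b k) * (g (cis t) * cis (- (of_nat k * t)))) = g (cis t) * cnj (P t)" for t
      unfolding cP by (simp add: sum_distrib_left algebra_simps)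
    ultimately show ?thesis by simp
  qed
  have Pk: "((\<lambda>t. P t * cis (- (of_nat k * t))) has_integral 2*pi*b k) {0..2*pi}" if "k \<in> S" for k
  proof -
    have "((\<lambda>t. \<Sum>j\<in>S. b j * (cis t ^ j * cis (- (of_nat k * t)))) has_integral
       (\<Sum>j\<in>S. b j * (2*pi*taylor_coeff (\<lambda>z. z ^ j) k))) {0..2*pi}"
      by (intro has_integral_sum S has_integral_mult_right taylor_coeff_integral[OF _ R] holomorphic_intros)
    moreover have "(\<Sum>j\<in>S. b j * (2*pi*taylor_coeff (\<lambda>z. z ^ j) k)) = 2*pi*b k"
      using that S by (simp add: taylor_coeff_monomial if_distrib sum.delta cong: if_cong)
    moreover have "(\<Sum>j\<in>S. b j * (cis t ^ j * cis (- (of_nat k * t)))) = P t * cis (- (of_nat k * t))" for t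
      by (simp only: P_def sum_distrib_right mult.assoc)
    ultimately show ?thesis by simp
  qed
  have PP: "((\<lambda>t. P t * cnj (P t)) has_integral of_real (2*pi * s)) {0..2*pi}"
  proof -
    have "((\<lambda>t. \<Sum>k\<in>S. cnj (b k) * (P t * cis (- (of_nat k * t)))) has_integral
       (\<Sum>k\<in>S. cnj (b k) * (2*pi*b k))) {0..2*pi}"
      by (intro has_integral_sum S has_integral_mult_right Pk)
    moreover have "(\<Sum>k\<in>S. cnj (b k) * (2*pi*b k)) = of_real (2*pi * s)"
      by (simp only: sq s_def sum_distrib_left of_real_sum)
    moreover have "(\<Sum>k\<in>S. cnj (b k) * (P t * cis (- (of_nat k * t)))) = P t * cnj (P t)" for t
      unfolding cP by (simp add: sum_distrib_left algebra_simps)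
    ultimately show ?thesis by simp
  qed
  have "((\<lambda>t. 2 * (g (cis t) * cnj (P t)) - P t * cnj (P t)) has_integral 2 * of_real (2*pi * s) - of_real (2*pi * s)) {0..2*pi}"
    by (intro has_integral_diff has_integral_mult_right gP PP)
  from has_integral_linear[OF this bounded_linear_Re]
  have low: "((\<lambda>t. Re (2 * (g (cis t) * cnj (P t)) - P t * cnj (P t))) has_integral 2*pi * s) {0..2*pi}"
    by (simp add: o_def mult.assoc)
  have cg: "continuous_on {0..2*pi} (\<lambda>t. g (cis t))"
    by (rule continuous_on_compose2[OF holomorphic_on_imp_continuous_on[OF g]])
       (use R in \<open>auto intro!: continuous_intros\<close>)
  have "(\<lambda>t. (cmod (g (cis t)))^2) integrable_on {0..2*pi}"
    by (intro integrable_continuous_real continuous_intros cg)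
  then have up: "((\<lambda>t. (cmod (g (cis t)))^2) has_integral integral {0..2*pi} (\<lambda>t. (cmod (g (cis t)))^2)) {0..2*pi}"
    by (rule integrable_integral)
  have pw: "Re (2 * (u * cnj v) - v * cnj v) \<le> (cmod u)^2" for u v
  proof -
    have "(cmod u)^2 - Re (2 * (u * cnj v) - v * cnj v) = (Re u - Re v)^2 + (Im u - Im v)^2"
      unfolding cmod_power2 by (simp add: power2_eq_square algebra_simps)
    then show ?thesis by (smt (verit) zero_le_power2)
  qed
  have "2*pi * s \<le> integral {0..2*pi} (\<lambda>t. (cmod (g (cis t)))^2)"
    by (rule has_integral_le[OF low up]) (rule pw)
  then show ?thesis unfolding s_def b_def by (simp add: field_simps)
qed

lemma taylor_coeff_0: "taylor_coeff f 0 = f 0"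
  by (simp add: taylor_coeff_def)

lemma taylor_coeff_cong:
  assumes "f holomorphic_on ball 0 R" "R > 0" "\<And>z. z \<in> ball 0 R \<Longrightarrow> f z = g z"
  shows "taylor_coeff f n = taylor_coeff g n"
proof -
  have "g holomorphic_on ball 0 R" by (rule holomorphic_transform[OF assms(1)]) (use assms(3) in auto)
  from higher_deriv_transform_within_open[OF assms(1) this open_ball, of 0 n] show ?thesis
    using assms(2,3) by (simp add: taylor_coeff_def)
qed

lemma taylor_coeff_cmult:
  assumes "f holomorphic_on ball 0 R" "R > 0"
  shows "taylor_coeff (\<lambda>z. c * f z) n = c * taylor_coeff f n"
  using higher_deriv_cmult[OF assms(1) _ open_ball, of 0 n c] assms(2) by (simp add: taylor_coeff_def)

lemma taylor_coeff_rescale: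
  assumes f: "f holomorphic_on ball 0 R" and R: "R > 0"
  shows "taylor_coeff (\<lambda>z. f (u * z)) n = u ^ n * taylor_coeff f n"
proof -
  define S where "S = {w. u * w \<in> ball 0 R}"
  have "open S" unfolding S_def
    using continuous_open_vimage[of "ball 0 R" "\<lambda>w. u * w"] by (auto simp: vimage_def intro!: continuous_intros)
  moreover have "0 \<in> S" using R by (simp add: S_def)
  ultimately have "(deriv ^^ n) (\<lambda>w. f (u * w)) 0 = u ^ n * (deriv ^^ n) f (u * 0)"
    by (intro higher_deriv_compose_linear[OF f]) (auto simp: S_def)
  then show ?thesis by (simp add: taylor_coeff_def)
qed

lemma taylor_coeff_mult_2:
  assumes "f holomorphic_on ball 0 R" "g holomorphic_on ball 0 R" "R > 0"
  shows "taylor_coeff (\<lambda>z. f z * g z) 2 =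
    taylor_coeff f 2 * g 0 + taylor_coeff f 1 * taylor_coeff g 1 + f 0 * taylor_coeff g 2"
  using higher_deriv_mult[OF assms(1,2) open_ball, of 0 2] assms(3)
  by (simp add: taylor_coeff_def numeral_2_eq_2 field_simps)

lemma taylor_coeff_exp:
  assumes l: "l holomorphic_on ball 0 R" and R: "R > 0"
  shows "taylor_coeff (\<lambda>z. exp (c * l z)) 1 = exp (c * l 0) * (c * taylor_coeff l 1)"
    "taylor_coeff (\<lambda>z. exp (c * l z)) 2 =
      exp (c * l 0) * (c * taylor_coeff l 2 + (c * taylor_coeff l 1)^2 / 2)"
proof -
  define E where "E = (\<lambda>z. exp (c * l z))"
  have hE: "E holomorphic_on ball 0 R" unfolding E_def by (intro holomorphic_intros l)
  have hl: "deriv l holomorphic_on ball 0 R" using l by (intro holomorphic_deriv) auto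
  have dl: "(l has_field_derivative deriv l z) (at z)" if "z \<in> ball 0 R" for z
    using holomorphic_derivI[OF l _ that] by simp
  have ddl: "(deriv l has_field_derivative deriv (deriv l) z) (at z)" if "z \<in> ball 0 R" for z
    using holomorphic_derivI[OF hl _ that] by simp
  have dE: "(E has_field_derivative E z * (c * deriv l z)) (at z)" if "z \<in> ball 0 R" for z
    unfolding E_def by (rule derivative_eq_intros dl[OF that] refl | simp)+
  have d1: "deriv E z = E z * (c * deriv l z)" if "z \<in> ball 0 R" for z
    using dE[OF that] by (rule DERIV_imp_deriv)
  have 0: "0 \<in> ball (0::complex) R" using R by simp
  have "((\<lambda>z. E z * (c * deriv l z)) has_field_derivative
      E 0 * (c * deriv l 0) * (c * deriv l 0) + c * deriv (deriv l) 0 * E 0) (at 0)"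
    by (rule DERIV_mult dE[OF 0] DERIV_cmult ddl[OF 0])+
  then have "deriv (\<lambda>z. E z * (c * deriv l z)) 0 = E 0 * (c * deriv l 0) * (c * deriv l 0) + c * deriv (deriv l) 0 * E 0"
    by (rule DERIV_imp_deriv)
  moreover have "deriv (deriv E) 0 = deriv (\<lambda>z. E z * (c * deriv l z)) 0"
    by (rule complex_derivative_transform_within_open[OF _ _ open_ball 0 d1])
       (intro holomorphic_deriv holomorphic_intros hE hl open_ball)+
  ultimately show "taylor_coeff (\<lambda>z. exp (c * l z)) 2 =
      exp (c * l 0) * (c * taylor_coeff l 2 + (c * taylor_coeff l 1)^2 / 2)"
    unfolding E_def[symmetric]
    by (simp add: taylor_coeff_def numeral_2_eq_2 field_simps) (simp add: E_def algebra_simps)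
  show "taylor_coeff (\<lambda>z. exp (c * l z)) 1 = exp (c * l 0) * (c * taylor_coeff l 1)"
    unfolding E_def[symmetric] using d1[OF 0] by (simp add: taylor_coeff_def E_def)
qed

text \<open>
  The factor \<open>g\<^sup>m\<close> is \<open>exp (m l)\<close> for a logarithm \<open>l\<close> of \<open>g\<close>; the coefficients of \<open>g\<close> and of \<open>g\<^sup>m\<close>
  are both expressed by those of \<open>l\<close>.
\<close>

lemma taylor_coeff_2_product:
  fixes m a :: real
  assumes h: "h holomorphic_on ball 0 R" and l: "l holomorphic_on ball 0 R" and R: "R > 0"
    and l0: "l 0 = of_real a" and h0: "h 0 = \<mu> * of_real (exp a)"
  defines "g \<equiv> \<lambda>z. exp (l z)"
  shows "taylor_coeff (\<lambda>z. h z * exp (of_real m * l z)) 2 =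
    coeff_functional m (exp a) \<mu> (taylor_coeff g 1) (taylor_coeff g 2) (taylor_coeff h 1) (taylor_coeff h 2)"
proof -
  define l1 l2 where "l1 = taylor_coeff l 1" and "l2 = taylor_coeff l 2"
  define X where "X = complex_of_real (exp a)"
  have g1: "taylor_coeff g 1 = X * l1" and g2: "taylor_coeff g 2 = X * (l2 + l1^2/2)"
    using taylor_coeff_exp[OF l R, of 1] by (simp_all add: g_def l0 l1_def l2_def X_def exp_of_real)
  have X: "X \<noteq> 0" by (simp add: X_def)
  define Y where "Y = complex_of_real (exp a powr (m-1))"
  have Xm: "exp (of_real m * l 0) = Y * X"
    unfolding l0 X_def Y_def
    by (simp add: powr_def exp_of_real[symmetric] of_real_mult[symmetric] del: of_real_mult flip: exp_add) (simp add: algebra_simps)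
  have 1: "taylor_coeff (\<lambda>z. exp (of_real m * l z)) 1 = Y * X * (of_real m * l1)"
    and 2: "taylor_coeff (\<lambda>z. exp (of_real m * l z)) 2 = Y * X * (of_real m * l2 + (of_real m * l1)^2/2)"
    using taylor_coeff_exp[OF l R, of "of_real m"] by (simp_all add: Xm l1_def l2_def)
  have "(\<lambda>z. exp (of_real m * l z)) holomorphic_on ball 0 R" by (intro holomorphic_intros l)
  note tm = taylor_coeff_mult_2[OF h this R]
  show ?thesis
    unfolding tm 1 2 coeff_functional_def g1 g2 Xm h0 X_def[symmetric] Y_def[symmetric]
    by (simp add: field_simps power2_eq_square)
qed

section \<open>Finite Blaschke products\<close>

lemma holomorphic_split_zero:
  assumes F: "F holomorphic_on S" and S: "open S" "connected S" "a \<in> S" and nz: "\<exists>w\<in>S. F w \<noteq> 0"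
  obtains g n where "g holomorphic_on S" "g a \<noteq> 0" "\<And>w. w \<in> S \<Longrightarrow> F w = (w - a) ^ n * g w"
proof -
  define n where "n = nat (zorder F a)"
  from zorder_exist_zero[OF F S nz] obtain r where r: "r > 0" "cball a r \<subseteq> S"
    "zor_poly F a holomorphic_on cball a r"
    "\<And>w. w \<in> cball a r \<Longrightarrow> F w = zor_poly F a w * (w - a) ^ n \<and> zor_poly F a w \<noteq> 0"
    unfolding n_def by blast
  define g where "g = (\<lambda>w. if w = a then zor_poly F a a else F w / (w - a) ^ n)"
  have "g holomorphic_on ball a r"
  proof (rule holomorphic_transform)
    show "zor_poly F a holomorphic_on ball a r" using r(3) by (rule holomorphic_on_subset) auto
    show "zor_poly F a w = g w" if "w \<in> ball a r" for w
      using r(4)[of w] that by (auto simp: g_def)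
  qed
  moreover have "g holomorphic_on S - {a}"
  proof (rule holomorphic_transform)
    show "(\<lambda>w. F w / (w - a) ^ n) holomorphic_on S - {a}"
      by (intro holomorphic_intros holomorphic_on_subset[OF F]) auto
  qed (auto simp: g_def)
  ultimately have "g holomorphic_on ball a r \<union> (S - {a})"
    using S by (intro holomorphic_on_Un open_delete) auto
  moreover have "ball a r \<union> (S - {a}) = S" using r S by (auto simp: subset_iff)
  ultimately have "g holomorphic_on S" by simp
  moreover have "g a \<noteq> 0" using r(4)[of a] r(1) by (simp add: g_def)
  moreover have "F w = (w - a) ^ n * g w" if "w \<in> S" for w
    using r(4)[of a] r(1) by (cases "w = a") (simp_all add: g_def)
  ultimately show ?thesis using that by blast
qed

text \<open>
  Zeros in the disc are removed one at a time: the factor \<open>(z - a)\<^sup>n\<close> is traded for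
  \<open>(1 - cnj a z)\<^sup>n\<close>, which has the same modulus on the unit circle and no zero in the disc. When no zero
  is left, a logarithm exists on a slightly larger disc. The constant in \<open>B\<close> makes this logarithm real
  at \<open>0\<close>.
\<close>

lemma blaschke_factorization:
  assumes "F holomorphic_on ball 0 R" "R > 1" "\<And>z. cmod z = 1 \<Longrightarrow> F z \<noteq> 0"
  shows "\<exists>R' B l. R' > 1 \<and> B holomorphic_on ball 0 R' \<and> l holomorphic_on ball 0 R' \<and>
    (\<forall>z\<in>ball 0 R'. F z = B z * exp (l z)) \<and> (\<forall>z. cmod z = 1 \<longrightarrow> cmod (B z) = 1) \<and> Im (l 0) = 0"
  using assms(1,3)
proof (induction "card {z\<in>ball 0 1. F z = 0}" arbitrary: F rule: less_induct)
  case less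
  note F = less.prems(1) and circ = less.prems(2)
  have sub: "cball 0 1 \<subseteq> ball (0::complex) R" using assms(2) by auto
  have fin: "finite {z\<in>cball 0 1. F z = 0}"
  proof (cases "F constant_on ball 0 R")
    case True
    then have eq: "F z = F 1" if "z \<in> cball 0 1" for z
      using that sub unfolding constant_on_def by (metis mem_cball_0 norm_one order_refl subsetD)
    have "F z \<noteq> 0" if "z \<in> cball 0 1" for z
      unfolding eq[OF that] using circ[of 1] by simp
    then have "{z\<in>cball 0 1. F z = 0} = {}" by blast
    then show ?thesis by (simp only: finite.emptyI)
  next
    case False
    then show ?thesis
      by (intro holomorphic_compact_finite_zeros[OF F]) (use sub in auto)
  qed
  show ?case
  proof (cases "{z\<in>ball 0 1. F z = 0} = {}")
    case True
    have nz: "F z \<noteq> 0" if "z \<in> cball 0 1" for z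
      using True circ[of z] that by (cases "cmod z = 1") auto
    have "open {z\<in>ball 0 R. F z \<noteq> 0}"
      using continuous_open_preimage[OF holomorphic_on_imp_continuous_on[OF F] open_ball, of "- {0}"]
      by (simp add: vimage_def Int_def open_Compl)
    moreover have "cball 0 1 \<subseteq> {z\<in>ball 0 R. F z \<noteq> 0}" using nz sub by auto
    ultimately obtain e where e: "e > 0" "(\<Union>x\<in>cball 0 1. ball x e) \<subseteq> {z\<in>ball 0 R. F z \<noteq> 0}"
      using compact_subset_open_imp_ball_epsilon_subset[OF compact_cball] by blast
    have big: "ball 0 (1 + e) \<subseteq> {z\<in>ball 0 R. F z \<noteq> 0}"
    proof
      fix z :: complex assume z: "z \<in> ball 0 (1 + e)"
      show "z \<in> {z\<in>ball 0 R. F z \<noteq> 0}"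
      proof (cases "cmod z \<le> 1")
        case True then show ?thesis using e by (intro subsetD[OF e(2)]) (auto intro!: bexI[of _ z])
      next
        case False
        have "dist (sgn z) z < e"
        proof -
          have "sgn z - z = (1 - cmod z) *\<^sub>R sgn z"
          proof -
            have "z \<noteq> 0" using False by auto
            then show ?thesis by (simp add: sgn_div_norm left_diff_distrib scaleR_left_diff_distrib)
          qed
          then have "dist (sgn z) z = \<bar>1 - cmod z\<bar> * cmod (sgn z)"
            by (simp add: dist_norm)
          then show ?thesis using z False by (auto simp: norm_sgn split: if_splits)
        qed
        then show ?thesis using False by (intro subsetD[OF e(2)]) (auto simp: norm_sgn intro!: bexI[of _ "sgn z"])
      qed
    qed
    then have "F holomorphic_on ball 0 (1 + e)" "\<And>z. z \<in> ball 0 (1 + e) \<Longrightarrow> F z \<noteq> 0"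
      using F holomorphic_on_subset by blast+
    then obtain L where L: "L holomorphic_on ball 0 (1 + e)" "\<And>z. z \<in> ball 0 (1 + e) \<Longrightarrow> F z = exp (L z)"
      using contractible_imp_holomorphic_log[of F "ball 0 (1+e)"] by (metis convex_imp_contractible convex_ball)
    define c where "c = \<i> * of_real (Im (L 0))"
    show ?thesis
    proof (intro exI conjI ballI allI impI)
      show "1 + e > 1" using e by simp
      show "(\<lambda>_. exp c) holomorphic_on ball 0 (1+e)" "(\<lambda>z. L z - c) holomorphic_on ball 0 (1+e)"
        by (intro holomorphic_intros L)+
      show "F z = exp c * exp (L z - c)" if "z \<in> ball 0 (1+e)" for z
        using L(2)[OF that] by (simp flip: exp_add)
      show "cmod (exp c) = 1" for z :: complex by (simp add: c_def)
      show "Im (L 0 - c) = 0" by (simp add: c_def)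
    qed
  next
    case False
    then obtain a where a: "cmod a < 1" "F a = 0" by auto
    have aR: "a \<in> ball 0 R" using a assms(2) by auto
    have "\<exists>w\<in>ball 0 R. F w \<noteq> 0" using circ[of 1] assms(2) by (intro bexI[of _ 1]) auto
    from holomorphic_split_zero[OF F open_ball connected_ball aR this]
    obtain g n where g: "g holomorphic_on ball 0 R" "g a \<noteq> 0"
      "\<And>w. w \<in> ball 0 R \<Longrightarrow> F w = (w - a) ^ n * g w" by blast
    have nz: "1 - cnj a * w \<noteq> 0" if "cmod a * cmod w < 1" for w
    proof
      assume "1 - cnj a * w = 0"
      then have "cmod (cnj a * w) = 1" by (metis eq_iff_diff_eq_0 norm_one)
      then show False using that by (simp add: norm_mult)
    qed
    define F' where "F' = (\<lambda>w. g w * (1 - cnj a * w) ^ n)"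
    have F': "F' holomorphic_on ball 0 R" unfolding F'_def by (intro holomorphic_intros g)
    have zeros: "{z\<in>ball 0 1. F' z = 0} = {z\<in>ball 0 1. F z = 0} - {a}"
    proof -
      have "F' z = 0 \<longleftrightarrow> F z = 0 \<and> z \<noteq> a" if "cmod z < 1" for z
      proof -
        have "cmod a * cmod z < 1" using that a by (smt (verit) mult_left_le norm_ge_zero mult_le_one)
        then have "1 - cnj a * z \<noteq> 0" by (rule nz)
        moreover have "F z = (z - a) ^ n * g z" using g(3)[of z] that assms(2) by simp
        ultimately show ?thesis using g(2) a(2) by (auto simp: F'_def)
      qed
      then show ?thesis by auto
    qed
    have cl: "card {z\<in>ball 0 1. F' z = 0} < card {z\<in>ball 0 1. F z = 0}"
      unfolding zeros
    proof (rule card_Diff1_less)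
      show "finite {z\<in>ball 0 1. F z = 0}" by (rule finite_subset[OF _ fin]) auto
    qed (use a in auto)
    have mob: "cmod (z - a) = cmod (1 - cnj a * z)" if "cmod z = 1" for z
    proof -
      have "1 - cnj a * z = z * cnj (z - a)"
        using that complex_norm_square[of z] by (simp add: algebra_simps)
      then show ?thesis using that by (simp add: norm_mult del: complex_cnj_diff)
    qed
    have nz': "F' z \<noteq> 0" if z: "cmod z = 1" for z
    proof -
      have "F z \<noteq> 0" "F z = (z - a) ^ n * g z" using circ[OF z] g(3)[of z] z assms(2) by auto
      moreover have "1 - cnj a * z \<noteq> 0" by (rule nz) (use a z in simp)
      ultimately show ?thesis by (simp add: F'_def)
    qed
    from less.hyps[OF cl F' nz'] obtain R' B l where IH: "R' > 1" "B holomorphic_on ball 0 R'" "l holomorphic_on ball 0 R'"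
      "\<And>z. z\<in>ball 0 R' \<Longrightarrow> F' z = B z * exp (l z)" "\<And>z. cmod z = 1 \<Longrightarrow> cmod (B z) = 1" "Im (l 0) = 0"
      by blast
    define R2 where "R2 = min R (min R' (2 / (1 + cmod a)))"
    have R2: "R2 > 1" "R2 \<le> R'" "R2 \<le> R"
      using IH(1) a assms(2) by (auto simp: R2_def field_simps add_pos_nonneg)
    have nz2: "1 - cnj a * w \<noteq> 0" if "w \<in> ball 0 R2" for w
    proof (rule nz)
      have "cmod a * cmod w \<le> cmod a * (2 / (1 + cmod a))"
        using that by (intro mult_left_mono) (auto simp: R2_def)
      also have "\<dots> < 1" using a by (simp add: field_simps add_pos_nonneg)
      finally show "cmod a * cmod w < 1" .
    qed
    define B2 where "B2 = (\<lambda>w. B w * ((w - a) / (1 - cnj a * w)) ^ n)"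
    show ?thesis
    proof (rule exI[of _ R2], rule exI[of _ B2], rule exI[of _ l], intro conjI ballI allI impI)
      show "R2 > 1" by (rule R2)
      show "B2 holomorphic_on ball 0 R2" unfolding B2_def
        by (intro holomorphic_intros holomorphic_on_subset[OF IH(2)] nz2) (use R2 in auto)
      show "l holomorphic_on ball 0 R2" by (rule holomorphic_on_subset[OF IH(3)]) (use R2 in auto)
      show "F z = B2 z * exp (l z)" if z: "z \<in> ball 0 R2" for z
      proof -
        have "F z = (z - a) ^ n * g z" "B z * exp (l z) = g z * (1 - cnj a * z) ^ n"
          using z R2 g(3)[of z] IH(4)[of z] by (auto simp: F'_def)
        then show ?thesis using nz2[OF z] by (simp add: B2_def power_divide field_simps)
      qed
      show "cmod (B2 z) = 1" if z: "cmod z = 1" for z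
      proof -
        have "1 - cnj a * z \<noteq> 0" by (rule nz) (use a z in simp)
        then show ?thesis using IH(5)[OF z] mob[OF z] by (simp add: B2_def norm_mult norm_power norm_divide)
      qed
      show "Im (l 0) = 0" by (rule IH(6))
    qed
  qed
qed

section \<open>The extremal function\<close>

lemma extremal_value_powr: "m > 0 \<Longrightarrow> extremal_value m = (m+1) * (m/(m+1)) powr m"
proof -
  assume m: "m > 0"
  have "(m+1) * (m/(m+1)) powr m = (m+1) * ((m/(m+1)) powr (m-1) * (m/(m+1)))"
    using m by (simp add: powr_diff)
  also have "\<dots> = m * (m/(m+1)) powr (m-1)" using m by (simp add: divide_simps)
  finally show ?thesis by (simp add: extremal_value_def)
qed

context
  fixes p m :: real
  assumes p: "0 < p" "p < 1" and m_def: "m = 2/p - 1"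
begin

lemma m_gt_1: "m > 1" using p by (simp add: m_def field_simps)

lemma extremal_quadratic_eq:
  "extremal_quadratic p z = 1 + of_real (sqrt (2/m)) * z + of_real (1/m) * z^2"
proof -
  have "p / (2 - p) = 1/m" using p by (simp add: m_def divide_simps)
  moreover have "2*p / (2 - p) = 2/m" using p by (simp add: m_def divide_simps)
  ultimately show ?thesis by (simp only: extremal_quadratic_def)
qed

lemma one_minus_half: "1 - p/2 = m/(m+1)"
  using p by (simp add: m_def divide_simps)

lemma extremal_quadratic_holomorphic: "extremal_quadratic p holomorphic_on S"
  unfolding extremal_quadratic_def by (intro holomorphic_intros)

lemma extremal_quadratic_0: "extremal_quadratic p 0 = 1"
  by (simp add: extremal_quadratic_def)

lemma extremal_log:
  "disc_log (extremal_quadratic p) holomorphic_on ball 0 1" "disc_log (extremal_quadratic p) 0 = 0"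
  "\<And>z. z \<in> ball 0 1 \<Longrightarrow> exp (disc_log (extremal_quadratic p) z) = extremal_quadratic p z"
  using disc_log[OF extremal_quadratic_holomorphic _ extremal_quadratic_0]
    extremal_quadratic_nonzero[OF p] by blast+

lemma extremal_fun_exp:
  "extremal_fun p z = of_real ((m/(m+1)) powr (m+1)) * exp (of_real (m+1) * disc_log (extremal_quadratic p) z)"
proof -
  have "2/p = m+1" by (simp add: m_def)
  then show ?thesis by (simp only: extremal_fun_def disc_power_def one_minus_half)
qed

lemma extremal_fun_holomorphic: "extremal_fun p holomorphic_on ball 0 1"
  unfolding extremal_fun_exp by (intro holomorphic_intros extremal_log)

lemma extremal_fun_nonzero: "extremal_fun p z \<noteq> 0"
  using m_gt_1 by (simp add: extremal_fun_exp)

lemma cmod_extremal_fun: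
  assumes "z \<in> ball 0 1"
  shows "cmod (extremal_fun p z) = (m/(m+1) * cmod (extremal_quadratic p z)) powr (m+1)"
proof -
  define L where "L = disc_log (extremal_quadratic p) z"
  have e: "exp L = extremal_quadratic p z" unfolding L_def by (rule extremal_log(3)[OF assms])
  have "cmod (exp (of_real (m+1) * L)) = exp (Re L) powr (m+1)"
    by (simp add: powr_def)
  also have "exp (Re L) = cmod (extremal_quadratic p z)" by (metis e norm_exp_eq_Re)
  finally have "cmod (exp (of_real (m+1) * L)) = cmod (extremal_quadratic p z) powr (m+1)" .
  moreover have "(m/(m+1) * cmod (extremal_quadratic p z)) powr (m+1) =
      (m/(m+1)) powr (m+1) * cmod (extremal_quadratic p z) powr (m+1)"
    by (subst powr_mult) (use m_gt_1 in auto)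
  ultimately show ?thesis by (simp add: extremal_fun_exp norm_mult flip: L_def)
qed

lemma taylor_coeff_extremal_quadratic:
  "taylor_coeff (extremal_quadratic p) 1 = of_real (sqrt (2/m))"
  "taylor_coeff (extremal_quadratic p) 2 = of_real (1/m)"
proof -
  have d: "deriv (extremal_quadratic p) = (\<lambda>z. of_real (sqrt (2/m)) + 2 * of_real (1/m) * z)"
    unfolding extremal_quadratic_eq[abs_def]
    by (rule ext, rule DERIV_imp_deriv) (rule derivative_eq_intros refl | simp)+
  have "deriv (\<lambda>z::complex. of_real (sqrt (2/m)) + 2 * of_real (1/m) * z) 0 = 2 * of_real (1/m)"
    by (rule DERIV_imp_deriv) (rule derivative_eq_intros refl | simp)+
  then show "taylor_coeff (extremal_quadratic p) 1 = of_real (sqrt (2/m))"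
    "taylor_coeff (extremal_quadratic p) 2 = of_real (1/m)"
    by (simp_all add: taylor_coeff_def d numeral_2_eq_2)
qed

lemma taylor_coeff_extremal_fun: "taylor_coeff (extremal_fun p) 2 = of_real (extremal_value m)"
proof -
  define L where "L = disc_log (extremal_quadratic p)"
  note L = extremal_log[folded L_def]
  have eq: "taylor_coeff (\<lambda>z. exp (1 * L z)) n = taylor_coeff (extremal_quadratic p) n" for n
    by (rule taylor_coeff_cong[of _ 1]) (auto intro!: holomorphic_intros L simp: L(3))
  note t = taylor_coeff_exp[OF L(1) zero_less_one, of 1, unfolded eq taylor_coeff_extremal_quadratic]
  have l1: "taylor_coeff L 1 = of_real (sqrt (2/m))" using t(1) L(2) by simp
  have "(of_real (sqrt (2/m)))^2 = complex_of_real (2/m)"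
    using m_gt_1 by (simp flip: of_real_power)
  then have sq: "(taylor_coeff L 1)^2 = of_real (2/m)" unfolding l1 .
  have l2: "taylor_coeff L 2 = 0" using t(2) L(2) sq by (simp add: field_simps)
  have "taylor_coeff (extremal_fun p) 2 = of_real ((m/(m+1)) powr (m+1)) *
      taylor_coeff (\<lambda>z. exp (of_real (m+1) * L z)) 2"
    unfolding extremal_fun_exp L_def[symmetric]
    by (rule taylor_coeff_cmult[of _ 1]) (auto intro!: holomorphic_intros L)
  also have "taylor_coeff (\<lambda>z. exp (of_real (m+1) * L z)) 2 = of_real ((m+1)^2/m)"
    unfolding taylor_coeff_exp(2)[OF L(1) zero_less_one, of "of_real (m+1)"] power_mult_distrib sq l2 L(2)
    by (simp add: field_simps)
  also have "of_real ((m/(m+1)) powr (m+1)) * complex_of_real ((m+1)^2/m) =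
      of_real ((m/(m+1)) powr (m+1) * ((m+1)^2/m))" by simp
  also have "(m/(m+1)) powr (m+1) * ((m+1)^2/m) = extremal_value m"
  proof -
    have "(m/(m+1)) powr (m+1) = (m/(m+1)) powr (m-1) * (m/(m+1)) powr 2"
      using powr_add[of "m/(m+1)" "m-1" 2] by (simp add: add.commute)
    also have "(m/(m+1)) powr 2 = (m/(m+1))^2" using m_gt_1 by simp
    finally show ?thesis using m_gt_1
      by (simp add: extremal_value_def power_divide) (simp add: divide_simps power2_eq_square)
  qed
  finally show ?thesis .
qed

text \<open>
  On a circle, \<open>\<bar>f\<bar>\<^sup>p\<close> is the squared modulus of a quadratic polynomial, so the mean is the sum of the
  squares of the moduli of its terms.
\<close>

lemma hardy_mean_rotated_extremal:
  assumes f: "\<And>z. z \<in> ball 0 1 \<Longrightarrow> cmod (f z) = cmod (extremal_fun p (cis \<theta> * z))"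
    and r: "0 \<le> r" "r < 1"
  shows "hardy_mean p f r = (m/(m+1))^2 * (1 + 2/m*r^2 + 1/m^2*r^4)"
proof -
  define b c where "b = sqrt (2/m)" and "c = 1/m"
  have b2: "b^2 = 2/m" using m_gt_1 by (simp add: b_def)
  define A where "A = 1 + b^2*r^2 + c^2*r^4"
  define w where "w = (\<lambda>t. A + 2*b*r*(1+c*r^2)* cos (t+\<theta>) + 2*c*r^2* cos (2*(t+\<theta>)))"
  have q: "(cmod (extremal_quadratic p (cis \<theta> * (of_real r * cis t))))^2 = w t" for t
  proof -
    define C S where "C = cos (t+\<theta>)" and "S = sin (t+\<theta>)"
    have S2: "S^2 = 1 - C^2" by (simp add: S_def C_def sin_squared_eq)
    have cs1: "C^2 + S^2 = 1" using S2 by simp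
    have cs2: "C^2 - S^2 = cos (2*(t+\<theta>))" by (simp only: C_def S_def cos_double)
    have z: "cis \<theta> * (of_real r * cis t) = of_real r * cis (t+\<theta>)"
      by (simp add: cis_mult add.commute mult_ac)
    have q: "extremal_quadratic p (of_real r * cis (t+\<theta>)) =
        Complex (1 + b*r*C + c*r^2*(C^2-S^2)) (b*r*S + 2*c*r^2*C*S)"
      unfolding extremal_quadratic_eq b_def[symmetric] c_def[symmetric]
      by (simp add: complex_eq_iff C_def S_def power2_eq_square algebra_simps)
    have "(1 + b*r*C + c*r^2*(C^2-S^2))^2 + (b*r*S + 2*c*r^2*C*S)^2 =
        1 + 2*b*r*C + 2*c*r^2*(C^2-S^2) + b^2*r^2*(C^2+S^2) + 2*b*c*r^3*C*(C^2+S^2) + c^2*r^4*(C^2+S^2)^2"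
      by algebra
    also have "\<dots> = w t"
      unfolding cs1 cs2 by (simp add: w_def A_def C_def power2_eq_square power3_eq_cube algebra_simps)
    finally show ?thesis by (simp only: z q cmod_power2 complex.sel)
  qed
  have integrand: "norm (f (of_real r * cis t)) powr p / (2*pi) = (m/(m+1))^2/(2*pi) * w t" for t
  proof -
    define y where "y = m/(m+1) * cmod (extremal_quadratic p (cis \<theta> * (of_real r * cis t)))"
    have y: "y \<ge> 0" using m_gt_1 by (simp add: y_def)
    have "norm (f (of_real r * cis t)) = y powr (m+1)"
      using f[of "of_real r * cis t"] cmod_extremal_fun[of "cis \<theta> * (of_real r * cis t)"] r
      by (simp add: norm_mult y_def)
    also have "\<dots> powr p = y powr ((m+1)*p)" by (simp add: powr_powr)
    also have "(m+1)*p = 2" using p by (simp add: m_def)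
    also have "y powr 2 = y^2" using y by simp
    also have "\<dots> = (m/(m+1))^2 * w t" by (simp only: y_def power_mult_distrib q)
    finally show ?thesis by simp
  qed
  define W where "W = (\<lambda>t. A*t + 2*b*r*(1+c*r^2)* sin (t+\<theta>) + c*r^2* sin (2*(t+\<theta>)))"
  have "(w has_integral (W (2*pi) - W 0)) {0..2*pi}"
  proof (rule fundamental_theorem_of_calculus)
    fix t assume "t \<in> {0..2*pi}"
    have "(W has_real_derivative w t) (at t)"
      unfolding W_def w_def by (rule derivative_eq_intros refl)+ (simp add: algebra_simps)
    then show "(W has_vector_derivative w t) (at t within {0..2*pi})"
      by (simp add: has_real_derivative_iff_has_vector_derivative has_vector_derivative_at_within)
  qed simp
  moreover have "W (2*pi) - W 0 = 2*pi*A"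
  proof -
    have "sin (2*pi + \<theta>) = sin \<theta>" by (simp add: sin_add)
    moreover have "sin (2*(2*pi + \<theta>)) = sin (2*\<theta>)"
      by (simp only: sin_double[of "2*pi+\<theta>"] sin_double[of \<theta>]) (simp add: sin_add cos_add)
    ultimately show ?thesis by (simp add: W_def)
  qed
  ultimately have "(w has_integral (2*pi*A)) {0..2*pi}" by (simp only:)
  then have "((\<lambda>t. (m/(m+1))^2/(2*pi) * w t) has_integral ((m/(m+1))^2/(2*pi) * (2*pi*A))) {0..2*pi}"
    by (rule has_integral_mult_right)
  then have "hardy_mean p f r = (m/(m+1))^2/(2*pi) * (2*pi*A)"
    unfolding hardy_mean_def integrand by (rule integral_unique)
  also have "\<dots> = (m/(m+1))^2 * A" by simp
  finally show ?thesis unfolding A_def b2 by (simp only: c_def power_one_over)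
qed

lemma hardy_mean_rotated_extremal_tendsto:
  assumes f: "\<And>z. z \<in> ball 0 1 \<Longrightarrow> cmod (f z) = cmod (extremal_fun p (cis \<theta> * z))"
  shows "(hardy_mean p f \<longlongrightarrow> 1) (at_left 1)"
proof -
  have lim: "((\<lambda>r. (m/(m+1))^2 * (1 + 2/m*r^2 + 1/m^2*r^4)) \<longlongrightarrow>
      (m/(m+1))^2 * (1 + 2/m*1^2 + 1/m^2*1^4)) (at_left 1)"
    by (intro tendsto_intros)
  have one: "(m/(m+1))^2 * (1 + 2/m*1^2 + 1/m^2*1^4) = 1"
    using m_gt_1 by (simp add: divide_simps) (simp add: power2_eq_square algebra_simps)
  have ev: "\<forall>\<^sub>F r in at_left 1. (m/(m+1))^2 * (1 + 2/m*r^2 + 1/m^2*r^4) = hardy_mean p f r"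
  proof -
    have "\<forall>\<^sub>F r in at_left (1::real). r \<in> {0<..<1}" by (rule eventually_at_left_real) simp
    then show ?thesis
    proof (rule eventually_mono)
      fix r :: real assume "r \<in> {0<..<1}"
      then have "0 \<le> r" "r < 1" by auto
      from hardy_mean_rotated_extremal[OF f this]
      show "(m/(m+1))^2 * (1 + 2/m*r^2 + 1/m^2*r^4) = hardy_mean p f r" by (rule sym)
    qed
  qed
  show ?thesis by (rule Lim_transform_eventually[OF lim[unfolded one] ev])
qed

end

section \<open>The normalised factorisation\<close>

lemma cmod_le_one_of_circle:
  assumes B: "B holomorphic_on ball 0 R" and R: "R > 1"
    and circ: "\<And>z. cmod z = 1 \<Longrightarrow> cmod (B z) = 1" and z: "cmod z \<le> 1"
  shows "cmod (B z) \<le> 1"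
proof (rule maximum_modulus_frontier[of B "cball 0 1"])
  have sub: "cball 0 1 \<subseteq> ball (0::complex) R" using R by auto
  show "B holomorphic_on interior (cball 0 1)"
    by (rule holomorphic_on_subset[OF B]) (use sub interior_subset in blast)
  show "continuous_on (closure (cball 0 1)) B"
    using holomorphic_on_imp_continuous_on[OF B] sub continuous_on_subset by fastforce
qed (use z circ in auto)

text \<open>
  With \<open>F z = f (r z) = B z exp (L z)\<close>, take \<open>l = p/2 L - ln M / 2\<close>, so that \<open>exp l\<close> is the normalised
  power \<open>p/2\<close> of the zero-free part, and \<open>h = B exp l\<close>. On the circle both satisfy
  \<open>\<bar>h\<bar>\<^sup>2 = \<bar>exp l\<bar>\<^sup>2 = \<bar>F\<bar>\<^sup>p / M\<close>, whose mean is \<open>1\<close>.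
\<close>

lemma normalised_factorization:
  fixes p m r :: real
  assumes p: "p > 0" and m: "m = 2/p - 1"
    and f: "f holomorphic_on ball 0 1" and r: "0 < r" "r < 1"
    and circ: "\<forall>z. cmod z = r \<longrightarrow> f z \<noteq> 0"
  defines "M \<equiv> hardy_mean p f r"
  obtains h l a where "h holomorphic_on ball 0 1" "l holomorphic_on ball 0 1" "l 0 = of_real a"
    "\<And>z. z \<in> ball 0 1 \<Longrightarrow> f (of_real r * z) = of_real (M powr (1/p)) * (h z * exp (of_real m * l z))"
    "\<And>z. z \<in> ball 0 1 \<Longrightarrow> cmod (h z) \<le> cmod (exp (l z))"
    "\<And>S. finite S \<Longrightarrow> (\<Sum>k\<in>S. (cmod (taylor_coeff (\<lambda>z. exp (l z)) k))^2) \<le> 1"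
    "\<And>S. finite S \<Longrightarrow> (\<Sum>k\<in>S. (cmod (taylor_coeff h k))^2) \<le> 1"
proof -
  define F where "F = (\<lambda>z. f (of_real r * z))"
  have r1: "1/r > 1" using r by simp
  have F: "F holomorphic_on ball 0 (1/r)"
    unfolding F_def
  proof (rule holomorphic_on_compose_gen[OF _ f, unfolded o_def])
    show "(*) (complex_of_real r) holomorphic_on ball 0 (1/r)" by (intro holomorphic_intros)
    show "(*) (complex_of_real r) ` ball 0 (1/r) \<subseteq> ball 0 1" using r by (auto simp: norm_mult field_simps)
  qed
  have Fc: "F z \<noteq> 0" if "cmod z = 1" for z
    unfolding F_def using circ that r by (simp add: norm_mult)
  from blaschke_factorization[OF F r1 Fc] obtain R B L where
    R: "R > 1" and B: "B holomorphic_on ball 0 R" and L: "L holomorphic_on ball 0 R"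
    and FBL: "\<And>z. z \<in> ball 0 R \<Longrightarrow> F z = B z * exp (L z)"
    and Bc: "\<And>z. cmod z = 1 \<Longrightarrow> cmod (B z) = 1" and L0: "Im (L 0) = 0" by blast
  have sub: "ball 0 1 \<subseteq> ball (0::complex) R" using R by auto
  define G where "G = (\<lambda>z. exp (of_real (p/2) * L z))"
  have G: "G holomorphic_on ball 0 R" unfolding G_def by (intro holomorphic_intros L)
  have GF: "(cmod (G (cis t)))^2 = cmod (f (of_real r * cis t)) powr p" for t
  proof -
    have "cmod (f (of_real r * cis t)) = exp (Re (L (cis t)))"
      using FBL[of "cis t"] Bc[of "cis t"] R by (simp add: F_def norm_mult)
    then have "cmod (f (of_real r * cis t)) powr p = exp (p * Re (L (cis t)))"
      by (simp add: powr_def)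
    also have "\<dots> = (exp (p/2 * Re (L (cis t))))^2" by (simp flip: exp_double)
    also have "exp (p/2 * Re (L (cis t))) = cmod (G (cis t))" by (simp add: G_def)
    finally show ?thesis by simp
  qed
  \<comment> \<open>Positivity of \<open>M\<close> follows from Bessel, as \<open>G 0 \<noteq> 0\<close>.\<close>
  have "(cmod (taylor_coeff G 0))^2 \<le> M"
    using bessel[OF G R, of "{0}"] by (simp add: GF M_def hardy_mean_def)
  moreover have "taylor_coeff G 0 \<noteq> 0" by (simp add: taylor_coeff_0 G_def)
  then have "(cmod (taylor_coeff G 0))^2 > 0" by simp
  ultimately have M: "M > 0" by linarith
  define a where "a = p/2 * Re (L 0) - ln M / 2"
  define l where "l = (\<lambda>z. of_real (p/2) * L z - of_real (ln M / 2))"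
  define h where "h = (\<lambda>z. B z * exp (l z))"
  have l: "l holomorphic_on ball 0 R" unfolding l_def by (intro holomorphic_intros L)
  have h: "h holomorphic_on ball 0 R" unfolding h_def by (intro holomorphic_intros B l)
  have g: "(\<lambda>z. exp (l z)) holomorphic_on ball 0 R" by (intro holomorphic_intros l)
  have gG: "(cmod (exp (l z)))^2 = (cmod (G z))^2 / M" for z
  proof -
    have "exp (l z) = G z / exp (of_real (ln M / 2))" by (simp add: l_def G_def exp_diff)
    then have "(cmod (exp (l z)))^2 = (cmod (G z))^2 / (exp (ln M / 2))^2"
      by (simp add: norm_divide power_divide)
    also have "(exp (ln M / 2))^2 = M" using M by (simp flip: exp_double)
    finally show ?thesis .
  qed
  have mean: "integral {0..2*pi} (\<lambda>t. (cmod (exp (l (cis t))))^2 / (2*pi)) = 1"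
  proof -
    have "integral {0..2*pi} (\<lambda>t. (cmod (exp (l (cis t))))^2 / (2*pi)) =
        integral {0..2*pi} (\<lambda>t. norm (f (of_real r * cis t)) powr p / (2*pi) / M)"
      unfolding gG GF by (simp add: mult_ac)
    also have "\<dots> = M / M" unfolding M_def hardy_mean_def by (rule integral_divide)
    finally show ?thesis using M by simp
  qed
  have meanh: "integral {0..2*pi} (\<lambda>t. (cmod (h (cis t)))^2 / (2*pi)) = 1"
    using mean by (simp add: h_def norm_mult Bc)
  have fac: "F z = of_real (M powr (1/p)) * (h z * exp (of_real m * l z))" if z: "z \<in> ball 0 R" for z
  proof -
    have "exp (l z) * exp (of_real m * l z) = exp (of_real (m+1) * l z)"
      by (simp add: algebra_simps flip: exp_add)
    also have "of_real (m+1) * l z = L z - of_real (ln M / p)"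
    proof -
      have "(m+1) * (p/2) = 1" "(m+1) * (ln M/2) = ln M/p" using p by (simp_all add: m)
      then have "complex_of_real (m+1) * of_real (p/2) = 1"
        "complex_of_real (m+1) * of_real (ln M/2) = of_real (ln M/p)"
        by (metis of_real_mult of_real_1)+
      then show ?thesis unfolding l_def right_diff_distrib mult.assoc[symmetric] by simp
    qed
    also have "exp (L z - of_real (ln M / p)) = exp (L z) / exp (of_real (ln M / p))" by (rule exp_diff)
    also have "exp (complex_of_real (ln M / p)) = of_real (M powr (1/p))"
      unfolding exp_of_real using M by (simp add: powr_def)
    finally have "h z * exp (of_real m * l z) = B z * (exp (L z) / of_real (M powr (1/p)))"
      by (simp add: h_def mult.assoc)
    then show ?thesis using FBL[OF z] M by simp
  qed
  have l0: "l 0 = of_real a"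
    using L0 by (simp add: l_def a_def complex_eq_iff)
  show ?thesis
  proof (rule that)
    show "h holomorphic_on ball 0 1" "l holomorphic_on ball 0 1"
      using h l sub holomorphic_on_subset by blast+
    show "l 0 = of_real a" by (rule l0)
    show "f (of_real r * z) = of_real (M powr (1/p)) * (h z * exp (of_real m * l z))" if "z \<in> ball 0 1" for z
      using fac[of z] that sub by (auto simp: F_def)
    show "cmod (h z) \<le> cmod (exp (l z))" if "z \<in> ball 0 1" for z
      using cmod_le_one_of_circle[OF B R Bc, of z] that
      by (simp add: h_def norm_mult mult_left_le_one_le)
    show "(\<Sum>k\<in>S. (cmod (taylor_coeff (\<lambda>z. exp (l z)) k))^2) \<le> 1" if "finite S" for S
      using bessel[OF g R that] unfolding mean .
    show "(\<Sum>k\<in>S. (cmod (taylor_coeff h k))^2) \<le> 1" if "finite S" for S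
      using bessel[OF h R that] unfolding meanh .
  qed
qed

lemma zero_free_circle:
  assumes f: "f holomorphic_on ball 0 1" and nz: "\<exists>z\<in>ball 0 1. f z \<noteq> 0"
    and ab: "0 \<le> a" "a < b" "b < 1"
  shows "\<exists>r. a < r \<and> r < b \<and> (\<forall>z. cmod z = r \<longrightarrow> f z \<noteq> 0)"
proof (cases "f constant_on ball 0 1")
  case True
  then obtain c where c: "\<And>z. z \<in> ball 0 1 \<Longrightarrow> f z = c" unfolding constant_on_def by blast
  then have "c \<noteq> 0" using nz by auto
  then show ?thesis using c ab by (intro exI[of _ "(a+b)/2"]) auto
next
  case False
  have "finite {z\<in>cball 0 b. f z = 0}"
    by (intro holomorphic_compact_finite_zeros[OF f]) (use False ab in auto)
  then have "finite (cmod ` {z\<in>cball 0 b. f z = 0})" by (rule finite_imageI)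
  moreover have "infinite {a<..<b}" using ab by (simp add: infinite_Ioo)
  ultimately obtain r where "r \<in> {a<..<b}" "r \<notin> cmod ` {z\<in>cball 0 b. f z = 0}"
    by (meson finite_subset subsetI)
  then show ?thesis by (intro exI[of _ r]) (force simp: image_iff)
qed

text \<open>
  Every annulus inside the disc contains such a circle, since a closed disc of radius less than \<open>1\<close>
  contains only finitely many zeros.
\<close>

lemma zero_free_radii:
  assumes f: "f holomorphic_on ball 0 1" and nz: "\<exists>z\<in>ball 0 1. f z \<noteq> 0"
  obtains r :: "nat \<Rightarrow> real" where "\<And>n. 0 < r n" "\<And>n. r n < 1" "\<And>n. \<forall>z. cmod z = r n \<longrightarrow> f z \<noteq> 0"
    "filterlim r (at_left 1) sequentially"
proof -
  have "\<exists>r. 1 - 1 / real (n+2) < r \<and> r < 1 - 1 / real (n+3) \<and> (\<forall>z. cmod z = r \<longrightarrow> f z \<noteq> 0)" for n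
    by (rule zero_free_circle[OF f nz]) (auto simp: field_simps)
  then obtain r where r: "\<And>n. 1 - 1 / real (n+2) < r n" "\<And>n. r n < 1 - 1 / real (n+3)"
    "\<And>n. \<forall>z. cmod z = r n \<longrightarrow> f z \<noteq> 0" by metis
  have r1: "r n < 1" for n by (rule less_trans[OF r(2)]) simp
  have r0: "0 < r n" for n
    by (rule le_less_trans[OF _ r(1)]) (simp add: field_simps)
  have "(\<lambda>n. 1 / real (n+2)) \<longlonglongrightarrow> 0"
    using LIMSEQ_ignore_initial_segment[OF lim_1_over_n, of 2] by simp
  then have "(\<lambda>n. 1 - 1 / real (n+2)) \<longlonglongrightarrow> 1 - 0" by (intro tendsto_intros)
  then have "r \<longlonglongrightarrow> 1"
    using tendsto_sandwich[of "\<lambda>n. 1 - 1 / real (n+2)" r sequentially "\<lambda>_. 1" 1] r1 r(1)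
    by (simp add: less_imp_le)
  then have "filterlim r (at_left 1) sequentially"
    by (rule filterlim_at_withinI) (use r1 in \<open>auto simp: less_le\<close>)
  then show ?thesis using that r0 r1 r(3) by blast
qed

lemma hardy_mean_nonneg: "hardy_mean p f r \<ge> 0"
  unfolding hardy_mean_def
proof (cases "(\<lambda>t. norm (f (of_real r * cis t)) powr p / (2*pi)) integrable_on {0..2*pi}")
  case True
  then show "0 \<le> integral {0..2*pi} (\<lambda>t. norm (f (of_real r * cis t)) powr p / (2*pi))"
    by (rule integral_nonneg) simp
next
  case False
  then show "0 \<le> integral {0..2*pi} (\<lambda>t. norm (f (of_real r * cis t)) powr p / (2*pi))"
    by (subst not_integrable_integral) auto
qed

text \<open>
  By Bessel for the index set \<open>{0, 1, 2, k}\<close>, every single coefficient with index \<open>k \<ge> 3\<close> is bounded by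
  what the first three leave over.
\<close>

lemma taylor_tail:
  assumes g: "g holomorphic_on ball 0 1"
    and bessel: "\<And>S. finite S \<Longrightarrow> (\<Sum>k\<in>S. (cmod (taylor_coeff g k))^2) \<le> 1"
    and z: "cmod z < 1"
  shows "cmod (g z - (\<Sum>k<3. taylor_coeff g k * z^k)) \<le>
    sqrt (1 - (\<Sum>k<3. (cmod (taylor_coeff g k))^2)) / (1 - cmod z)"
proof -
  define \<epsilon> where "\<epsilon> = sqrt (1 - (\<Sum>k<3. (cmod (taylor_coeff g k))^2))"
  have e0: "\<epsilon> \<ge> 0" using bessel[of "{..<3}"] by (simp add: \<epsilon>_def)
  have coeff: "cmod (taylor_coeff g (k+3)) \<le> \<epsilon>" for k
  proof -
    have "(\<Sum>k\<in>insert (k+3) {..<3}. (cmod (taylor_coeff g k))^2) \<le> 1" by (rule bessel) simp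
    then have "(cmod (taylor_coeff g (k+3)))^2 \<le> 1 - (\<Sum>k<3. (cmod (taylor_coeff g k))^2)"
      by (subst (asm) sum.insert) auto
    then show ?thesis unfolding \<epsilon>_def by (rule real_le_rsqrt)
  qed
  have "(\<lambda>n. taylor_coeff g n * z^n) sums g z" by (rule taylor_coeff_sums[OF g]) (use z in simp)
  then have s: "(\<lambda>n. taylor_coeff g (n+3) * z^(n+3)) sums (g z - (\<Sum>k<3. taylor_coeff g k * z^k))"
    by (rule sums_split_initial_segment)
  have geo: "(\<lambda>n. \<epsilon> * cmod z ^ n) sums (\<epsilon> * (1 / (1 - cmod z)))"
    by (intro sums_mult geometric_sums) (use z in simp)
  have le: "cmod (taylor_coeff g (n+3) * z^(n+3)) \<le> \<epsilon> * cmod z ^ n" for n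
    unfolding norm_mult norm_power
  proof (rule mult_mono[OF coeff _ e0])
    show "cmod z ^ (n+3) \<le> cmod z ^ n" by (rule power_decreasing) (use z in auto)
  qed simp
  have "cmod (\<Sum>n. taylor_coeff g (n+3) * z^(n+3)) \<le> (\<Sum>n. \<epsilon> * cmod z ^ n)"
    by (rule norm_suminf_le[OF le sums_summable[OF geo]])
  then show ?thesis
    using sums_unique[OF s] sums_unique[OF geo] by (simp add: \<epsilon>_def)
qed

lemma tendsto_coeff_functional:
  assumes m: "m > 1" and x: "x \<longlonglongrightarrow> X" "\<And>n. x n \<ge> 0"
    and "\<mu> \<longlonglongrightarrow> M" "b1 \<longlonglongrightarrow> B1" "b2 \<longlonglongrightarrow> B2" "c1 \<longlonglongrightarrow> C1" "c2 \<longlonglongrightarrow> C2"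
  shows "(\<lambda>n. coeff_functional m (x n) (\<mu> n) (b1 n) (b2 n) (c1 n) (c2 n)) \<longlonglongrightarrow>
     coeff_functional m X M B1 B2 C1 C2"
proof -
  have P: "(\<lambda>n. x n powr (m-1)) \<longlonglongrightarrow> X powr (m-1)"
    by (rule tendsto_powr'[OF x(1) tendsto_const]) (use x(2) m in auto)
  then show ?thesis unfolding coeff_functional_def
    by (intro tendsto_mult tendsto_add tendsto_power tendsto_of_real tendsto_const P assms)
qed

text \<open>
  What the proof needs from the factorisation, in terms of finitely many numbers. The last estimate
  uses only \<open>\<bar>h\<bar> \<le> \<bar>g\<bar>\<close>; in it \<open>g\<close> is replaced by its quadratic Taylor polynomial, with an error
  that vanishes when the Bessel inequality for that polynomial becomes an equality.
\<close>

lemma normalised_coefficients: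
  fixes p m r :: real
  assumes p: "0 < p" "p < 1" and m: "m = 2/p - 1"
    and f: "f holomorphic_on ball 0 1" and r: "0 < r" "r < 1"
    and circ: "\<forall>z. cmod z = r \<longrightarrow> f z \<noteq> 0"
  defines "M \<equiv> hardy_mean p f r powr (1/p)"
  obtains x \<mu> b1 b2 c1 c2 where "x > 0" "cmod \<mu> \<le> 1"
    "x^2 + (cmod b1)^2 + (cmod b2)^2 \<le> 1" "(cmod \<mu> * x)^2 + (cmod c1)^2 + (cmod c2)^2 \<le> 1"
    "of_real (r^2) * taylor_coeff f 2 = of_real M * coeff_functional m x \<mu> b1 b2 c1 c2"
    "cmod (f 0) = M * (cmod \<mu> * x powr (m+1))"
    "\<And>z. z \<in> ball 0 1 \<Longrightarrow> cmod (f (of_real r * z)) \<le> M *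
       (cmod (of_real x + b1 * z + b2 * z^2) +
        sqrt (1 - (x^2 + (cmod b1)^2 + (cmod b2)^2)) / (1 - cmod z)) powr (m+1)"
proof -
  have m1: "m > 1" using m_gt_1[OF p m] .
  obtain h l a where h: "h holomorphic_on ball 0 1" and l: "l holomorphic_on ball 0 1"
    and l0: "l 0 = of_real a"
    and fac: "\<And>z. z \<in> ball 0 1 \<Longrightarrow> f (of_real r * z) = of_real M * (h z * exp (of_real m * l z))"
    and hg: "\<And>z. z \<in> ball 0 1 \<Longrightarrow> cmod (h z) \<le> cmod (exp (l z))"
    and bg: "\<And>S. finite S \<Longrightarrow> (\<Sum>k\<in>S. (cmod (taylor_coeff (\<lambda>z. exp (l z)) k))^2) \<le> 1"
    and bh: "\<And>S. finite S \<Longrightarrow> (\<Sum>k\<in>S. (cmod (taylor_coeff h k))^2) \<le> 1"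
  proof (rule normalised_factorization[OF p(1) m f r circ, folded M_def], goal_cases)
    case (1 h l a)
    then show ?case by (intro that[of h l a])
  qed
  have M: "M \<ge> 0" by (simp add: M_def)
  define g where "g = (\<lambda>z. exp (l z))"
  have g: "g holomorphic_on ball 0 1" unfolding g_def by (intro holomorphic_intros l)
  define x \<mu> where "x = exp a" and "\<mu> = h 0 / of_real x"
  define b1 b2 c1 c2 where "b1 = taylor_coeff g 1" and "b2 = taylor_coeff g 2"
    and "c1 = taylor_coeff h 1" and "c2 = taylor_coeff h 2"
  have x: "x > 0" by (simp add: x_def)
  have g0: "g 0 = of_real x" by (simp add: g_def l0 x_def exp_of_real)
  have h0: "h 0 = \<mu> * of_real (exp a)" by (simp add: \<mu>_def x_def)
  have mu: "cmod \<mu> \<le> 1" using hg[of 0] l0 by (simp add: \<mu>_def x_def norm_divide)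
  have s3: "(\<Sum>k<3. u k) = u 0 + u 1 + u 2" for u :: "nat \<Rightarrow> 'b::comm_monoid_add"
    by (simp add: numeral_3_eq_3 numeral_2_eq_2)
  have sg: "(\<Sum>k<3. (cmod (taylor_coeff g k))^2) = x^2 + (cmod b1)^2 + (cmod b2)^2"
    unfolding s3 taylor_coeff_0 b1_def b2_def g0 by simp
  have sh: "(\<Sum>k<3. (cmod (taylor_coeff h k))^2) = (cmod \<mu> * x)^2 + (cmod c1)^2 + (cmod c2)^2"
    unfolding s3 taylor_coeff_0 c1_def c2_def using x by (simp add: \<mu>_def norm_divide)
  have Bg: "x^2 + (cmod b1)^2 + (cmod b2)^2 \<le> 1"
    using bg[of "{..<3}"] unfolding g_def[symmetric] sg by simp
  have Bh: "(cmod \<mu> * x)^2 + (cmod c1)^2 + (cmod c2)^2 \<le> 1"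
    using bh[of "{..<3}"] unfolding sh by simp
  have a2: "of_real (r^2) * taylor_coeff f 2 = of_real (M) * coeff_functional m x \<mu> b1 b2 c1 c2"
  proof -
    have "of_real (r^2) * taylor_coeff f 2 = taylor_coeff (\<lambda>z. f (of_real r * z)) 2"
      using taylor_coeff_rescale[OF f zero_less_one, of "of_real r" 2] by simp
    also have "\<dots> = taylor_coeff (\<lambda>z. of_real (M) * (h z * exp (of_real m * l z))) 2"
      by (rule sym, rule taylor_coeff_cong[of _ 1]) (auto intro!: holomorphic_intros h l simp: fac)
    also have "\<dots> = of_real (M) * taylor_coeff (\<lambda>z. h z * exp (of_real m * l z)) 2"
      by (rule taylor_coeff_cmult[of _ 1]) (auto intro!: holomorphic_intros h l)
    also have "taylor_coeff (\<lambda>z. h z * exp (of_real m * l z)) 2 = coeff_functional m x \<mu> b1 b2 c1 c2"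
      unfolding x_def b1_def b2_def c1_def c2_def g_def
      by (rule taylor_coeff_2_product[OF h l zero_less_one l0 h0])
    finally show ?thesis .
  qed
  have em: "cmod (exp (of_real m * l z)) = cmod (g z) powr m" for z
    by (simp add: g_def powr_def)
  have f0: "cmod (f 0) = M * (cmod \<mu> * x powr (m+1))"
  proof -
    have "cmod (exp (of_real m * l 0)) = x powr m" unfolding em g0 using x by simp
    moreover have "cmod (h 0) = cmod \<mu> * x" unfolding h0 norm_mult x_def by simp
    moreover have "f 0 = of_real M * (h 0 * exp (of_real m * l 0))" using fac[of 0] by simp
    ultimately have "cmod (f 0) = M * (cmod \<mu> * x * x powr m)"
      using M by (simp only: norm_mult norm_of_real abs_of_nonneg)
    moreover have "x powr (m+1) = x * x powr m" using x by (simp add: powr_add)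
    ultimately show ?thesis by (simp add: mult.assoc)
  qed
  have bound: "cmod (f (of_real r * z)) \<le> M *
       (cmod (of_real x + b1 * z + b2 * z^2) +
        sqrt (1 - (x^2 + (cmod b1)^2 + (cmod b2)^2)) / (1 - cmod z)) powr (m+1)" if z: "z \<in> ball 0 1" for z
  proof -
    have gb: "cmod (g z) \<le> cmod (of_real x + b1 * z + b2 * z^2) +
        sqrt (1 - (x^2 + (cmod b1)^2 + (cmod b2)^2)) / (1 - cmod z)"
    proof -
      have "(\<Sum>k<3. taylor_coeff g k * z^k) = of_real x + b1 * z + b2 * z^2"
        unfolding s3 taylor_coeff_0 g0 b1_def b2_def by simp
      moreover have "cmod (g z - (\<Sum>k<3. taylor_coeff g k * z^k)) \<le>
        sqrt (1 - (\<Sum>k<3. (cmod (taylor_coeff g k))^2)) / (1 - cmod z)"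
        by (rule taylor_tail[OF g]) (use bg z in \<open>auto simp: g_def\<close>)
      ultimately show ?thesis unfolding sg
        using norm_triangle_sub[of "g z" "of_real x + b1 * z + b2 * z^2"] by simp
    qed
    have "cmod (f (of_real r * z)) = M * (cmod (h z) * cmod (g z) powr m)"
      unfolding fac[OF z] norm_mult em using M by simp
    also have "\<dots> \<le> M * (cmod (g z) * cmod (g z) powr m)"
      using hg[OF z] M by (intro mult_left_mono mult_right_mono) (auto simp: g_def)
    also have "cmod (g z) * cmod (g z) powr m = cmod (g z) powr (m+1)"
      by (simp add: g_def powr_add)
    also have "M * cmod (g z) powr (m+1) \<le> M * (cmod (of_real x + b1 * z + b2 * z^2) +
        sqrt (1 - (x^2 + (cmod b1)^2 + (cmod b2)^2)) / (1 - cmod z)) powr (m+1)"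
      using m1 gb M by (intro mult_left_mono powr_mono2) auto
    finally show ?thesis .
  qed
  show ?thesis by (rule that[OF x mu Bg Bh a2 f0 bound])
qed

section \<open>The sharp bound\<close>

lemma Re_taylor_coeff_le:
  fixes p m L :: real
  assumes p: "0 < p" "p < 1" and m: "m = 2/p - 1"
    and f: "f holomorphic_on ball 0 1" and L: "(hardy_mean p f \<longlongrightarrow> L) (at_left 1)"
  shows "Re (taylor_coeff f 2) \<le> extremal_value m * L powr (1/p)"
proof (cases "\<exists>z\<in>ball 0 1. f z \<noteq> 0")
  case False
  have "taylor_coeff f 2 = taylor_coeff (\<lambda>_. 0) 2"
    by (rule taylor_coeff_cong[OF f zero_less_one]) (use False in auto)
  also have "\<dots> = 0" by (simp add: taylor_coeff_def)
  finally show ?thesis using m_gt_1[OF p m] by (simp add: extremal_value_def)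
next
  case True
  have m1: "m > 1" using m_gt_1[OF p m] .
  from zero_free_radii[OF f True] obtain r where r: "\<And>n. 0 < r n" "\<And>n. r n < 1"
    "\<And>n. \<forall>z. cmod z = r n \<longrightarrow> f z \<noteq> 0" and rl: "filterlim r (at_left 1) sequentially" by metis
  define M where "M = (\<lambda>n. hardy_mean p f (r n))"
  have M: "M \<longlonglongrightarrow> L" unfolding M_def by (rule filterlim_compose[OF L rl])
  have le: "(r n)^2 * Re (taylor_coeff f 2) \<le> extremal_value m * M n powr (1/p)" for n
  proof -
    obtain x \<mu> b1 b2 c1 c2 where c: "x > 0" "cmod \<mu> \<le> 1"
      "x^2 + (cmod b1)^2 + (cmod b2)^2 \<le> 1" "(cmod \<mu> * x)^2 + (cmod c1)^2 + (cmod c2)^2 \<le> 1"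
      and eq: "of_real ((r n)^2) * taylor_coeff f 2 =
      of_real (M n powr (1/p)) * coeff_functional m x \<mu> b1 b2 c1 c2"
    proof (rule normalised_coefficients[OF p m f r(1) r(2) r(3)[of n]], goal_cases)
      case (1 x \<mu> b1 b2 c1 c2)
      then show ?case by (intro that[unfolded M_def, of x \<mu> b1 b2 c1 c2])
    qed
    have "(r n)^2 * Re (taylor_coeff f 2) = M n powr (1/p) * Re (coeff_functional m x \<mu> b1 b2 c1 c2)"
      using arg_cong[OF eq, of Re]
      by (simp only: times_complex.sel Re_complex_of_real Im_complex_of_real mult_zero_left diff_zero)
    also have "\<dots> \<le> M n powr (1/p) * extremal_value m"
      by (intro mult_left_mono coeff_functional_bound(1)[OF m1 _ c(2-4)]) (use c in auto)
    finally show ?thesis by (simp add: mult.commute)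
  qed
  have "r \<longlonglongrightarrow> 1" using rl by (simp add: filterlim_at)
  then have "(\<lambda>n. (r n)^2 * Re (taylor_coeff f 2)) \<longlonglongrightarrow> 1^2 * Re (taylor_coeff f 2)"
    by (intro tendsto_intros)
  moreover have "(\<lambda>n. extremal_value m * M n powr (1/p)) \<longlonglongrightarrow> extremal_value m * L powr (1/p)"
    by (intro tendsto_mult tendsto_const tendsto_powr'[OF M])
       (simp_all add: p M_def hardy_mean_nonneg)
  ultimately have "1^2 * Re (taylor_coeff f 2) \<le> extremal_value m * L powr (1/p)"
    by (rule LIMSEQ_le) (use le in blast)
  then show ?thesis by simp
qed

section \<open>Uniqueness of the extremal functions\<close>

lemma dominated_eq_cmult:
  assumes f: "f holomorphic_on ball 0 1" and E: "E holomorphic_on ball 0 1"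
    and nz: "\<And>z. z \<in> ball 0 1 \<Longrightarrow> E z \<noteq> 0"
    and le: "\<And>z. z \<in> ball 0 1 \<Longrightarrow> cmod (f z) \<le> cmod (E z)" and eq: "cmod (f 0) = cmod (E 0)"
  obtains c where "cmod c = 1" "\<And>z. z \<in> ball 0 1 \<Longrightarrow> f z = c * E z"
proof -
  define q where "q = (\<lambda>z. f z / E z)"
  have q: "q holomorphic_on ball 0 1" unfolding q_def by (intro holomorphic_intros f E nz)
  have q0: "cmod (q 0) = 1" using eq nz[of 0] by (simp add: q_def norm_divide)
  have "cmod (q z) \<le> cmod (q 0)" if "z \<in> ball 0 1" for z
    using le[OF that] nz[OF that] unfolding q0 by (simp add: q_def norm_divide)
  then have "q constant_on ball 0 1"
    by (intro maximum_modulus_principle[OF q open_ball connected_ball, of "ball 0 1" 0]) auto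
  then obtain c where c: "\<And>z. z \<in> ball 0 1 \<Longrightarrow> q z = c" unfolding constant_on_def by blast
  have "cmod c = 1" using q0 c[of 0] by simp
  moreover have "f z = c * E z" if "z \<in> ball 0 1" for z
    using c[OF that] nz[OF that] by (simp add: q_def field_simps)
  ultimately show ?thesis using that by blast
qed

text \<open>
  An extremal \<open>f\<close> may have infinitely many zeros and no continuous boundary values, so it is approached
  through circles of radii \<open>r n \<longlonglongrightarrow> 1\<close>, and the case of equality is applied to a limit point of the
  coefficient data.
\<close>

lemma extremal_unique:
  fixes p m :: real
  assumes p: "0 < p" "p < 1" and m: "m = 2/p - 1"
    and f: "f holomorphic_on ball 0 1" and lim: "(hardy_mean p f \<longlongrightarrow> 1) (at_left 1)"
    and ext: "Re (taylor_coeff f 2) = extremal_value m"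
  shows "\<exists>\<theta>. \<forall>z\<in>ball 0 1. f z = cis (-2*\<theta>) * extremal_fun p (cis \<theta> * z)"
proof -
  have m1: "m > 1" using m_gt_1[OF p m] .
  then have Kp: "extremal_value m > 0" by (simp add: extremal_value_def)
  have nz: "\<exists>z\<in>ball 0 1. f z \<noteq> 0"
  proof (rule ccontr)
    assume *: "\<not> (\<exists>z\<in>ball 0 1. f z \<noteq> 0)"
    have "taylor_coeff f 2 = taylor_coeff (\<lambda>_. 0) 2"
      by (rule taylor_coeff_cong[OF f zero_less_one]) (use * in auto)
    then show False using ext Kp by (simp add: taylor_coeff_def)
  qed
  from zero_free_radii[OF f nz] obtain r where r: "\<And>n. 0 < r n" "\<And>n. r n < 1"
    "\<And>n. \<forall>z. cmod z = r n \<longrightarrow> f z \<noteq> 0" and rl: "filterlim r (at_left 1) sequentially" by metis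
  have r1: "r \<longlonglongrightarrow> 1" using rl by (simp add: filterlim_at)
  define M where "M = (\<lambda>n. hardy_mean p f (r n) powr (1/p))"
  have "(\<lambda>n. hardy_mean p f (r n)) \<longlonglongrightarrow> 1" by (rule filterlim_compose[OF lim rl])
  then have "M \<longlonglongrightarrow> 1 powr (1/p)" unfolding M_def
    by (intro tendsto_powr tendsto_const) auto
  then have M: "M \<longlonglongrightarrow> 1" by simp
  define data where "data = (\<lambda>n (x, \<mu>, b1, b2, c1, c2). x > 0 \<and> cmod \<mu> \<le> 1 \<and>
    x^2 + (cmod b1)^2 + (cmod b2)^2 \<le> 1 \<and> (cmod \<mu> * x)^2 + (cmod c1)^2 + (cmod c2)^2 \<le> 1 \<and>
    of_real ((r n)^2) * taylor_coeff f 2 = of_real (M n) * coeff_functional m x \<mu> b1 b2 c1 c2 \<and>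
    cmod (f 0) = M n * (cmod \<mu> * x powr (m+1)) \<and>
    (\<forall>z\<in>ball 0 1. cmod (f (of_real (r n) * z)) \<le> M n *
       (cmod (of_real x + b1 * z + b2 * z^2) +
        sqrt (1 - (x^2 + (cmod b1)^2 + (cmod b2)^2)) / (1 - cmod z)) powr (m+1)))"
  have "\<exists>V. data n V" for n
  proof -
    show ?thesis
    proof (rule normalised_coefficients[OF p m f r(1) r(2) r(3)[of n]], goal_cases)
      case (1 x \<mu> b1 b2 c1 c2)
      then have "data n (x, \<mu>, b1, b2, c1, c2)" unfolding data_def prod.case M_def by (intro conjI ballI)
      then show ?case by (rule exI)
    qed
  qed
  then obtain V where V: "\<And>n. data n (V n)" by metis
  have one: "cmod u \<le> 1" if "(cmod u)^2 \<le> 1" for u :: complex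
    using that by (simp add: power2_le_iff_abs_le abs_square_le_1)
  have inK: "V n \<in> cball 0 1 \<times> cball 0 1 \<times> cball 0 1 \<times> cball 0 1 \<times> cball 0 1 \<times> cball 0 1" for n
  proof -
    obtain x \<mu> b1 b2 c1 c2 where v: "V n = (x, \<mu>, b1, b2, c1, c2)" by (metis prod.exhaust)
    have d: "x > 0" "cmod \<mu> \<le> 1" "x^2 + (cmod b1)^2 + (cmod b2)^2 \<le> 1"
      "(cmod \<mu> * x)^2 + (cmod c1)^2 + (cmod c2)^2 \<le> 1"
      using V[of n] unfolding v data_def prod.case by blast+
    have "x^2 \<le> 1" "(cmod b1)^2 \<le> 1" "(cmod b2)^2 \<le> 1" "(cmod c1)^2 \<le> 1" "(cmod c2)^2 \<le> 1"
      using d(3,4) by (smt (verit) zero_le_power2)+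
    then have "\<bar>x\<bar> \<le> 1" "cmod b1 \<le> 1" "cmod b2 \<le> 1" "cmod c1 \<le> 1" "cmod c2 \<le> 1"
      by (simp_all add: abs_square_le_1 one)
    then show ?thesis using d(2) by (simp add: v)
  qed
  have "compact (cball (0::real) 1 \<times> cball (0::complex) 1 \<times> cball (0::complex) 1 \<times>
      cball (0::complex) 1 \<times> cball (0::complex) 1 \<times> cball (0::complex) 1)"
    by (intro compact_Times compact_cball)
  from this[unfolded compact_def, rule_format, of V] inK
  obtain W s where s: "strict_mono s" and W: "(V \<circ> s) \<longlonglongrightarrow> W" by blast
  obtain X N B1 B2 C1 C2 where W_eq: "W = (X, N, B1, B2, C1, C2)" by (metis prod.exhaust)
  define x where "x = (\<lambda>n. fst (V (s n)))"
  define \<mu> where "\<mu> = (\<lambda>n. fst (snd (V (s n))))"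
  define b1 where "b1 = (\<lambda>n. fst (snd (snd (V (s n)))))"
  define b2 where "b2 = (\<lambda>n. fst (snd (snd (snd (V (s n))))))"
  define c1 where "c1 = (\<lambda>n. fst (snd (snd (snd (snd (V (s n)))))))"
  define c2 where "c2 = (\<lambda>n. snd (snd (snd (snd (snd (V (s n)))))))"
  have Vs: "V (s n) = (x n, \<mu> n, b1 n, b2 n, c1 n, c2 n)" for n
    by (simp add: x_def \<mu>_def b1_def b2_def c1_def c2_def)
  have W': "(\<lambda>n. V (s n)) \<longlonglongrightarrow> W" using W by (simp add: o_def)
  note t1 = tendsto_snd[OF W']
  note t2 = tendsto_snd[OF t1]
  note t3 = tendsto_snd[OF t2]
  note t4 = tendsto_snd[OF t3]
  have X: "x \<longlonglongrightarrow> X" and N: "\<mu> \<longlonglongrightarrow> N" and B1: "b1 \<longlonglongrightarrow> B1" and B2: "b2 \<longlonglongrightarrow> B2"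
    and C1: "c1 \<longlonglongrightarrow> C1" and C2: "c2 \<longlonglongrightarrow> C2"
    using tendsto_fst[OF W'] tendsto_fst[OF t1] tendsto_fst[OF t2] tendsto_fst[OF t3] tendsto_fst[OF t4]
      tendsto_snd[OF t4] unfolding W_eq x_def \<mu>_def b1_def b2_def c1_def c2_def by simp_all
  define \<rho> where "\<rho> = (\<lambda>n. r (s n))"
  define K where "K = (\<lambda>n. M (s n))"
  have \<rho>: "\<rho> \<longlonglongrightarrow> 1" unfolding \<rho>_def using LIMSEQ_subseq_LIMSEQ[OF r1 s] by (simp add: o_def)
  have K: "K \<longlonglongrightarrow> 1" unfolding K_def using LIMSEQ_subseq_LIMSEQ[OF M s] by (simp add: o_def)
  have d: "x n > 0" "cmod (\<mu> n) \<le> 1" "(x n)^2 + (cmod (b1 n))^2 + (cmod (b2 n))^2 \<le> 1"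
    "(cmod (\<mu> n) * x n)^2 + (cmod (c1 n))^2 + (cmod (c2 n))^2 \<le> 1"
    "of_real ((\<rho> n)^2) * taylor_coeff f 2 = of_real (K n) * coeff_functional m (x n) (\<mu> n) (b1 n) (b2 n) (c1 n) (c2 n)"
    "cmod (f 0) = K n * (cmod (\<mu> n) * x n powr (m+1))"
    "\<forall>z\<in>ball 0 1. cmod (f (of_real (\<rho> n) * z)) \<le> K n *
       (cmod (of_real (x n) + b1 n * z + b2 n * z^2) +
        sqrt (1 - ((x n)^2 + (cmod (b1 n))^2 + (cmod (b2 n))^2)) / (1 - cmod z)) powr (m+1)" for n
    using V[of "s n"] unfolding Vs data_def prod.case \<rho>_def K_def by blast+
  have X0: "X \<ge> 0" by (rule LIMSEQ_le_const[OF X]) (use d(1) less_imp_le in blast)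
  have N1: "cmod N \<le> 1"
    by (rule LIMSEQ_le_const2[OF tendsto_norm[OF N]]) (use d(2) in blast)
  have Bb: "X^2 + (cmod B1)^2 + (cmod B2)^2 \<le> 1"
  proof (rule LIMSEQ_le_const2)
    show "(\<lambda>n. (x n)^2 + (cmod (b1 n))^2 + (cmod (b2 n))^2) \<longlonglongrightarrow> X^2 + (cmod B1)^2 + (cmod B2)^2"
      by (intro tendsto_intros X B1 B2)
  qed (use d(3) in blast)
  have Cb: "(cmod N * X)^2 + (cmod C1)^2 + (cmod C2)^2 \<le> 1"
  proof (rule LIMSEQ_le_const2)
    show "(\<lambda>n. (cmod (\<mu> n) * x n)^2 + (cmod (c1 n))^2 + (cmod (c2 n))^2) \<longlonglongrightarrow>
        (cmod N * X)^2 + (cmod C1)^2 + (cmod C2)^2"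
      by (intro tendsto_intros X N C1 C2)
  qed (use d(4) in blast)
  have cf: "(\<lambda>n. coeff_functional m (x n) (\<mu> n) (b1 n) (b2 n) (c1 n) (c2 n)) \<longlonglongrightarrow>
     coeff_functional m X N B1 B2 C1 C2"
    by (rule tendsto_coeff_functional[OF m1 X _ N B1 B2 C1 C2]) (use d(1) less_imp_le in blast)
  have "(\<lambda>n. complex_of_real ((\<rho> n)^2) * taylor_coeff f 2) \<longlonglongrightarrow> of_real (1^2) * taylor_coeff f 2"
    by (intro tendsto_intros \<rho>)
  moreover have "(\<lambda>n. complex_of_real ((\<rho> n)^2) * taylor_coeff f 2) \<longlonglongrightarrow>
      of_real 1 * coeff_functional m X N B1 B2 C1 C2"
    unfolding d(5) by (intro tendsto_mult tendsto_of_real K cf)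
  ultimately have "of_real (1^2) * taylor_coeff f 2 = of_real 1 * coeff_functional m X N B1 B2 C1 C2"
    by (rule LIMSEQ_unique)
  then have "Re (coeff_functional m X N B1 B2 C1 C2) = extremal_value m" using ext by simp
  from coeff_functional_bound(2)[OF m1 X0 N1 Bb Cb this] obtain \<theta> where
    Xm: "X = m/(m+1)" and Nm: "cmod N = 1" and B1m: "B1 = of_real (sqrt (2*m)/(m+1)) * cis \<theta>"
    and B2m: "B2 = of_real (1/(m+1)) * cis (2*\<theta>)" by blast
  \<comment> \<open>No norm is left for later coefficients: the error terms in \<open>d(7)\<close> tend to \<open>0\<close>.\<close>
  have full: "X^2 + (cmod B1)^2 + (cmod B2)^2 = 1"
    using m1 unfolding Xm B1m B2m norm_mult norm_cis norm_of_real
    by (simp add: power_divide divide_simps) (simp add: power2_eq_square algebra_simps)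
  have P: "of_real X + B1 * z + B2 * z^2 = of_real (m/(m+1)) * extremal_quadratic p (cis \<theta> * z)" for z
  proof -
    have "m/(m+1) * sqrt (2/m) = sqrt (2*m)/(m+1)"
    proof -
      have "m * sqrt (2/m) = sqrt (m^2 * (2/m))" using m1 by (simp only: real_sqrt_mult real_sqrt_abs)
      also have "m^2 * (2/m) = 2*m" using m1 by (simp add: power2_eq_square)
      finally show ?thesis by simp
    qed
    then have e1: "complex_of_real (m/(m+1)) * of_real (sqrt (2/m)) = of_real (sqrt (2*m)/(m+1))"
      by (metis of_real_mult)
    have "m/(m+1) * (1/m) = 1/(m+1)" using m1 by simp
    then have e2: "complex_of_real (m/(m+1)) * of_real (1/m) = of_real (1/(m+1))"
      by (metis of_real_mult)
    have c2: "cis (2*\<theta>) = (cis \<theta>)^2" by (simp add: Complex.DeMoivre)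
    show ?thesis
      unfolding extremal_quadratic_eq[OF p m] Xm B1m B2m e1[symmetric] e2[symmetric] c2
      by algebra
  qed
  have rot: "cis \<theta> * z \<in> ball 0 1" if "z \<in> ball 0 1" for z using that by (simp add: norm_mult)
  define E where "E = (\<lambda>z. extremal_fun p (cis \<theta> * z))"
  have E: "E holomorphic_on ball 0 1" unfolding E_def
    by (rule holomorphic_on_compose_gen[OF _ extremal_fun_holomorphic[OF p m], unfolded o_def])
       (auto intro!: holomorphic_intros simp: norm_mult)
  have cE: "cmod (E z) = cmod (of_real X + B1 * z + B2 * z^2) powr (m+1)" if "z \<in> ball 0 1" for z
    unfolding E_def cmod_extremal_fun[OF p m rot[OF that]] P norm_mult norm_of_real using m1 by simp
  have le: "cmod (f z) \<le> cmod (E z)" if z: "z \<in> ball 0 1" for z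
  proof (rule LIMSEQ_le)
    have "isCont f z" using f z by (meson holomorphic_on_imp_continuous_on continuous_on_eq_continuous_at open_ball)
    moreover have "(\<lambda>n. of_real (\<rho> n) * z) \<longlonglongrightarrow> of_real 1 * z" by (intro tendsto_intros \<rho>)
    ultimately have "(\<lambda>n. f (of_real (\<rho> n) * z)) \<longlonglongrightarrow> f z" by (intro isCont_tendsto_compose[of z f]) auto
    then show "(\<lambda>n. cmod (f (of_real (\<rho> n) * z))) \<longlonglongrightarrow> cmod (f z)" by (rule tendsto_norm)
    have "(\<lambda>n. cmod (of_real (x n) + b1 n * z + b2 n * z^2) +
        sqrt (1 - ((x n)^2 + (cmod (b1 n))^2 + (cmod (b2 n))^2)) / (1 - cmod z)) \<longlonglongrightarrow>
      cmod (of_real X + B1 * z + B2 * z^2) + sqrt (1 - (X^2 + (cmod B1)^2 + (cmod B2)^2)) / (1 - cmod z)"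
      by (intro tendsto_intros X B1 B2) (use z in auto)
    then have "(\<lambda>n. K n * (cmod (of_real (x n) + b1 n * z + b2 n * z^2) +
        sqrt (1 - ((x n)^2 + (cmod (b1 n))^2 + (cmod (b2 n))^2)) / (1 - cmod z)) powr (m+1)) \<longlonglongrightarrow>
      1 * (cmod (of_real X + B1 * z + B2 * z^2) + sqrt (1 - (X^2 + (cmod B1)^2 + (cmod B2)^2)) / (1 - cmod z)) powr (m+1)"
      by (intro tendsto_mult K tendsto_powr'[OF _ tendsto_const])
         (use z m1 d(3) in \<open>auto intro!: always_eventually add_nonneg_nonneg divide_nonneg_nonneg\<close>)
    then show "(\<lambda>n. K n * (cmod (of_real (x n) + b1 n * z + b2 n * z^2) +
        sqrt (1 - ((x n)^2 + (cmod (b1 n))^2 + (cmod (b2 n))^2)) / (1 - cmod z)) powr (m+1)) \<longlonglongrightarrow> cmod (E z)"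
      unfolding full cE[OF z] by simp
  qed (use d(7) z in blast)
  have eq: "cmod (f 0) = cmod (E 0)"
  proof -
    have "(\<lambda>n. K n * (cmod (\<mu> n) * x n powr (m+1))) \<longlonglongrightarrow> 1 * (cmod N * X powr (m+1))"
      by (intro tendsto_mult K tendsto_norm N tendsto_powr[OF X tendsto_const]) (use Xm m1 in auto)
    then have "(\<lambda>n. cmod (f 0)) \<longlonglongrightarrow> 1 * (cmod N * X powr (m+1))" unfolding d(6)[symmetric] .
    then have "cmod (f 0) = 1 * (cmod N * X powr (m+1))" by (rule LIMSEQ_unique[OF tendsto_const])
    then show ?thesis using cE[of 0] Nm X0 by simp
  qed
  have E0: "E z \<noteq> 0" for z unfolding E_def by (rule extremal_fun_nonzero[OF p m])
  from dominated_eq_cmult[OF f E E0 le eq] obtain c where c: "cmod c = 1"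
    and fc: "\<And>z. z \<in> ball 0 1 \<Longrightarrow> f z = c * E z" by blast
  have "taylor_coeff f 2 = taylor_coeff (\<lambda>z. c * E z) 2"
    by (rule taylor_coeff_cong[OF f zero_less_one fc])
  also have "\<dots> = c * taylor_coeff E 2" by (rule taylor_coeff_cmult[OF E zero_less_one])
  also have "taylor_coeff E 2 = cis \<theta> ^ 2 * of_real (extremal_value m)"
    unfolding E_def taylor_coeff_rescale[OF extremal_fun_holomorphic[OF p m] zero_less_one]
      taylor_coeff_extremal_fun[OF p m] ..
  also have "cis \<theta> ^ 2 = cis (2*\<theta>)" by (simp add: Complex.DeMoivre)
  finally have "taylor_coeff f 2 = of_real (extremal_value m) * (c * cis (2*\<theta>))" by (simp add: mult_ac)
  then have "extremal_value m * Re (c * cis (2*\<theta>)) = extremal_value m" using ext by simp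
  then have "Re (c * cis (2*\<theta>)) = cmod (c * cis (2*\<theta>))" using Kp c by (simp add: norm_mult)
  then have "c * cis (2*\<theta>) = 1" using eq_cmod_of_Re c by (metis norm_cis norm_mult mult_1 of_real_1)
  then have "c * (cis (2*\<theta>) * cis (-2*\<theta>)) = cis (-2*\<theta>)" by (metis mult.assoc mult_1)
  then have "c = cis (-2*\<theta>)" by (simp add: cis_mult)
  then show ?thesis using fc unfolding E_def by blast
qed

section \<open>The coefficient constant and its extremal functions\<close>

lemma hardy_norm_eq:
  assumes "(hardy_mean p f \<longlongrightarrow> L) (at_left 1)"
  shows "hardy_norm p f = L powr (1/p)"
  using tendsto_Lim[OF _ assms] by (simp add: hardy_norm_def trivial_limit_at_left_real)

lemma hardy_mean_limit_nonneg:
  assumes "(hardy_mean p f \<longlongrightarrow> L) (at_left 1)"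
  shows "L \<ge> 0"
  by (rule tendsto_lowerbound[OF assms]) (simp_all add: hardy_mean_nonneg trivial_limit_at_left_real)

lemma norm_taylor_coeff_le:
  assumes p: "0 < p" "p < 1" and m: "m = 2/p - 1" and f: "f \<in> hardy_space p"
  shows "cmod (taylor_coeff f 2) \<le> extremal_value m * hardy_norm p f"
proof (cases "taylor_coeff f 2 = 0")
  case True
  then show ?thesis using m_gt_1[OF p m] by (simp add: extremal_value_def hardy_norm_def)
next
  case False
  obtain L where h: "f holomorphic_on ball 0 1" and L: "(hardy_mean p f \<longlongrightarrow> L) (at_left 1)"
    using f by (auto simp: hardy_space_def)
  \<comment> \<open>A rotation of the values makes the coefficient nonnegative without changing the means.\<close>
  define u where "u = cnj (sgn (taylor_coeff f 2))"
  have u: "cmod u = 1" using False by (simp add: u_def norm_sgn)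
  have "hardy_mean p (\<lambda>z. u * f z) = hardy_mean p f"
    by (rule ext) (simp add: hardy_mean_def norm_mult u)
  then have L': "(hardy_mean p (\<lambda>z. u * f z) \<longlongrightarrow> L) (at_left 1)" using L by simp
  have "(\<lambda>z. u * f z) holomorphic_on ball 0 1" by (intro holomorphic_intros h)
  from Re_taylor_coeff_le[OF p m this L']
  have "Re (u * taylor_coeff f 2) \<le> extremal_value m * L powr (1/p)"
    by (simp only: taylor_coeff_cmult[OF h zero_less_one])
  moreover have "u * taylor_coeff f 2 = of_real (cmod (taylor_coeff f 2))"
  proof -
    have "taylor_coeff f 2 = of_real (cmod (taylor_coeff f 2)) * sgn (taylor_coeff f 2)"
      using False by (simp add: sgn_eq)
    then have "u * taylor_coeff f 2 = of_real (cmod (taylor_coeff f 2)) * (sgn (taylor_coeff f 2) * cnj (sgn (taylor_coeff f 2)))"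
      by (metis mult.assoc mult.commute u_def)
    also have "sgn (taylor_coeff f 2) * cnj (sgn (taylor_coeff f 2)) = 1"
      using False complex_norm_square[of "sgn (taylor_coeff f 2)"] by (simp add: norm_sgn)
    finally show ?thesis by simp
  qed
  ultimately show ?thesis by (simp add: hardy_norm_eq[OF L])
qed

lemma rotated_extremal_admissible:
  assumes p: "0 < p" "p < 1" and m: "m = 2/p - 1"
    and f: "\<And>z. z \<in> ball 0 1 \<Longrightarrow> f z = cis (-2*\<theta>) * extremal_fun p (cis \<theta> * z)"
  shows "f \<in> hardy_space p" "hardy_norm p f = 1" "taylor_coeff f 2 = of_real (extremal_value m)"
proof -
  define E where "E = (\<lambda>z. extremal_fun p (cis \<theta> * z))"
  have E: "E holomorphic_on ball 0 1" unfolding E_def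
    by (rule holomorphic_on_compose_gen[OF _ extremal_fun_holomorphic[OF p m], unfolded o_def])
       (auto intro!: holomorphic_intros simp: norm_mult)
  have cE: "(\<lambda>z. cis (-2*\<theta>) * E z) holomorphic_on ball 0 1" by (intro holomorphic_intros E)
  have h: "f holomorphic_on ball 0 1" by (rule holomorphic_transform[OF cE]) (simp add: f E_def)
  have lim: "(hardy_mean p f \<longlongrightarrow> 1) (at_left 1)"
    by (rule hardy_mean_rotated_extremal_tendsto[OF p m, of _ \<theta>]) (simp add: f norm_mult)
  show "f \<in> hardy_space p" using h lim by (auto simp: hardy_space_def)
  show "hardy_norm p f = 1" using hardy_norm_eq[OF lim] by simp
  have "taylor_coeff f 2 = taylor_coeff (\<lambda>z. cis (-2*\<theta>) * E z) 2"
    by (rule taylor_coeff_cong[OF h zero_less_one]) (simp add: f E_def)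
  also have "\<dots> = cis (-2*\<theta>) * (cis \<theta> ^ 2 * of_real (extremal_value m))"
    unfolding taylor_coeff_cmult[OF E zero_less_one] unfolding E_def
      taylor_coeff_rescale[OF extremal_fun_holomorphic[OF p m] zero_less_one]
      taylor_coeff_extremal_fun[OF p m] ..
  also have "cis (-2*\<theta>) * (cis \<theta> ^ 2 * of_real (extremal_value m)) =
      (cis (-2*\<theta>) * cis (2*\<theta>)) * of_real (extremal_value m)"
    by (simp add: Complex.DeMoivre)
  also have "cis (-2*\<theta>) * cis (2*\<theta>) = 1" by (simp add: cis_mult)
  finally show "taylor_coeff f 2 = of_real (extremal_value m)" by simp
qed

theorem theorem1:
  fixes p :: real
  assumes "0 < p" and "p < 1"
  shows
    "(coeff_const 2 p \<in> coeff_bounds 2 p \<and> (\<forall>C\<in>coeff_bounds 2 p. coeff_const 2 p \<le> C)) \<and>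
     coeff_const 2 p = coeff_sup 2 p \<and>
     coeff_const 2 p = 2/p * (1 - p/2) powr (2/p - 1) \<and>
     coeff_extremal 2 p (extremal_fun p) \<and>
     (\<forall>f. coeff_extremal 2 p f \<longleftrightarrow>
       (\<exists>\<theta>::real. \<forall>z\<in>ball 0 1.
          f z = exp (- 2 * \<i> * of_real \<theta>) * extremal_fun p (exp (\<i> * of_real \<theta>) * z)))"
proof -
  define m where "m = 2/p - 1"
  note pm = assms m_def
  define K where "K = extremal_value m"
  have K: "K = 2/p * (1 - p/2) powr (2/p - 1)"
  proof -
    have s: "2/p = m + 1" by (simp add: m_def)
    have "K = (m+1) * (m/(m+1)) powr m"
      unfolding K_def using m_gt_1[OF pm] by (intro extremal_value_powr) simp
    then show ?thesis unfolding one_minus_half[OF pm] s by simp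
  qed
  have cis: "exp (- 2 * \<i> * of_real \<theta>) = cis (-2*\<theta>)" "exp (\<i> * of_real \<theta>) = cis \<theta>" for \<theta>
    by (simp_all add: cis_conv_exp mult_ac)
  note E = rotated_extremal_admissible[OF pm, of "extremal_fun p" 0, folded K_def, simplified]
  have bd: "cmod (taylor_coeff f 2) \<le> K * hardy_norm p f" if "f \<in> hardy_space p" for f
    unfolding K_def by (rule norm_taylor_coeff_le[OF pm that])
  have Kin: "K \<in> coeff_bounds 2 p" using bd by (auto simp: coeff_bounds_def)
  have Kle: "K \<le> C" if "C \<in> coeff_bounds 2 p" for C
  proof -
    have "cmod (taylor_coeff (extremal_fun p) 2) \<le> C * hardy_norm p (extremal_fun p)"
      using that E(1) unfolding coeff_bounds_def by blast
    then show ?thesis using E(2,3) by simp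
  qed
  have const: "coeff_const 2 p = K" 
    unfolding coeff_const_def by (rule Least_equality) (use Kin Kle in auto)
  have sup: "coeff_sup 2 p = K"
    unfolding coeff_sup_def
  proof (rule cSup_eq_maximum)
    show "K \<in> {Re (taylor_coeff f 2) |f. f \<in> hardy_space p \<and> hardy_norm p f = 1}"
      using E by (auto intro!: exI[of _ "extremal_fun p"])
    show "x \<le> K" if "x \<in> {Re (taylor_coeff f 2) |f. f \<in> hardy_space p \<and> hardy_norm p f = 1}" for x
    proof -
      from that obtain f where f: "x = Re (taylor_coeff f 2)" "f \<in> hardy_space p" "hardy_norm p f = 1"
        by blast
      have "Re (taylor_coeff f 2) \<le> cmod (taylor_coeff f 2)" by (rule complex_Re_le_cmod)
      also have "\<dots> \<le> K" using bd[OF f(2)] f(3) by simp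
      finally show ?thesis by (simp add: f)
    qed
  qed
  have ext: "coeff_extremal 2 p f \<longleftrightarrow> (\<exists>\<theta>. \<forall>z\<in>ball 0 1. f z = cis (-2*\<theta>) * extremal_fun p (cis \<theta> * z))" for f
  proof
    assume "coeff_extremal 2 p f"
    then have f: "f \<in> hardy_space p" "hardy_norm p f = 1" "Re (taylor_coeff f 2) = extremal_value m"
      by (auto simp: coeff_extremal_def sup K_def)
    then obtain L where h: "f holomorphic_on ball 0 1" and L: "(hardy_mean p f \<longlongrightarrow> L) (at_left 1)"
      by (auto simp: hardy_space_def)
    have "L powr (1/p) = 1" using f(2) hardy_norm_eq[OF L] by simp
    then have "(L powr (1/p)) powr p = 1" by simp
    then have "L = 1" using hardy_mean_limit_nonneg[OF L] assms by (simp add: powr_powr)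
    then show "\<exists>\<theta>. \<forall>z\<in>ball 0 1. f z = cis (-2*\<theta>) * extremal_fun p (cis \<theta> * z)"
      using extremal_unique[OF pm h _ f(3)] L by simp
  next
    assume "\<exists>\<theta>. \<forall>z\<in>ball 0 1. f z = cis (-2*\<theta>) * extremal_fun p (cis \<theta> * z)"
    then obtain \<theta> where "\<And>z. z\<in>ball 0 1 \<Longrightarrow> f z = cis (-2*\<theta>) * extremal_fun p (cis \<theta> * z)" by blast
    from rotated_extremal_admissible[OF pm this]
    show "coeff_extremal 2 p f" by (simp add: coeff_extremal_def sup K_def)
  qed
  have "coeff_extremal 2 p (extremal_fun p)"
    unfolding coeff_extremal_def sup using E by simp
  then show ?thesis unfolding cis using const sup Kin Kle K ext by simp
qed

end
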